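(* Let $V$ be an $m$-dimensional Euclidean space with inner product $h$, let $U\subset V$ be a domain, let $N$ be a Kähler manifold of complex dimension $n$, and let $\varphi:U\to N$ be a surjective sPHH submersion with totally geodesic fibres. Let $F=F^\varphi$ be the $f$-structure on $U$ induced by $\varphi$. Let $\Omega:U\to F_n(V^*,h^* )$ be the smooth map sending $x$ to the skew-symmetric endomorphism $F_x$ of $V\cong T_xU$ (regarded as a point of the orthogonal Grassmannian); it is constant along the fibres of $\varphi$, i.e. it factors as $\Omega=\omega\circ\varphi$ with $\omega:N\to F_n(V^*,h^* )$. Let $Q^\varphi:=\omega^*\mathcal Q$ be the pullback of the (realified) universal quotient bundle, with quotient map $\tau:N\times V\to Q^\varphi$. Over each $y\in N$, the fibre $\varphi^{-1}(y)$ is an open set in an affine $(m-2n)$-dimensional subspace of $V$, which is a translate of $\ker(\mathrm d\varphi_x)$ for any $x\in\varphi^{-1}(y)$. Let $\sigma$ be the section of $Q^\varphi$ whose image is the image under $\tau$ of the graph $\Gamma_\varphi=\{(\varphi(x),x):x\in U\}\subset N\times V$; that is, $\sigma(y)=\tau(y,x)\in V/\ker(\mathrm d\varphi_x)$ for any $x\in\varphi^{-1}(y)$ (the position vector of $\varphi^{-1}(y)$), which does not depend on the choice of $x$. Then the vector bundle $Q^\varphi$ is a holomorphic isotropic quotient of $N\times V$ and the section $\sigma$ is holomorphic.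
   Context: Orthogonal Grassmannian. Let $V_{\mathbb C}=V\otimes_{\mathbb R}\mathbb C$, $V_{\mathbb C}^*$ its complex dual, and $h^*_{\mathbb C}$ the complex symmetric bilinear form on $V^*_{\mathbb C}$ extending the inner product $h^*$ on $V^*$ induced by $h$. A complex quotient $V_{\mathbb C}\to\Lambda$ of dimension $n$ is isotropic if $h^*_{\mathbb C}|_{\Lambda^*\times\Lambda^*}\equiv 0$, where $\Lambda^*\subset V_{\mathbb C}^*$ is the dual inclusion. The orthogonal Grassmannian $F_n(V^*,h^* )=\{\Lambda^*\subset V_{\mathbb C}^*:\dim_{\mathbb C}\Lambda^*=n,\ h^*_{\mathbb C}|_{\Lambda^*\times\Lambda^*}\equiv0\}$ ($1\le n\le m/2$) is a closed complex submanifold of $\mathrm{Gr}_n(V_{\mathbb C}^* )$, carrying a universal holomorphic quotient $F_n(V^*,h^* )\times V_{\mathbb C}\to\mathfrak Q$ of rank $n$, with fibre $\Lambda$ at the point corresponding to $\Lambda$. $\mathcal Q$ denotes $\mathfrak Q$ regarded as a real vector bundle; the restricted map $F_n(V^*,h^* )\times V\to\mathcal Q$ is still surjective. Points as endomorphisms. Points of $F_n(V^*,h^* )$ correspond bijectively to skew-symmetric endomorphisms $F$ of $V$ of rank $2n$ with $F^3+F=0$: to $F$ one associates the quotient $V\to\mathrm{im}(F)\cong V/\ker(F)$ with the complex structure induced by $F$; conversely to an isotropic quotient $V\to\Lambda$ with real kernel $K$ one associates the endomorphism which is $0$ on $K$ and is the complex structure of $\Lambda$ on $K^\perp\cong\Lambda$.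 Isotropic quotient bundles. A real quotient bundle $N\times V\to E$ of rank $2n$ is isotropic if it has an almost complex structure $J_E$ ($J_E^2=-\mathrm{id}$) such that each fibre $(E_y,J_E)$ is an isotropic quotient of $V$ (i.e. the complex-linear extension $V_{\mathbb C}\to E_y$ is an isotropic quotient). It is a holomorphic isotropic quotient if it is the realification of a holomorphic quotient bundle of $N\times V_{\mathbb C}$: in local holomorphic trivializations $E\cong N\times\mathbb C^n$, the map $N\times V\to\mathbb C^n$ is holomorphic in the $N$ variable. By the universal property, $Q^\varphi$ being a holomorphic isotropic quotient is equivalent to $\omega$ being holomorphic, and then $Q^\varphi$ carries the holomorphic structure of $\omega^*\mathfrak Q$. $f$-structures. An $f$-structure of rank $2n$ on a Riemannian manifold $M$ of dimension $m$ is a skew-symmetric endomorphism $F$ of $TM$ with $F^3+F=0$ and $\mathrm{rk}(\ker F)=m-2n$. For a submersion $\varphi:M\to N$ to a Kähler manifold with complex structure $J_N$, vectors in $\ker \mathrm d\varphi$ are vertical and those in $(\ker\mathrm d\varphi)^\perp$ horizontal; $\mathscr H$ denotes the horizontal component. $F^\varphi$ is the endomorphism of $TM$ which vanishes on vertical vectors, preserves the horizontal distribution, and satisfies $\mathrm d\varphi\circ F^\varphi=J_N\circ\mathrm d\varphi$. The submersion $\varphi$ is PHWC (pseudo-horizontally weakly conformal) if $F^\varphi$ is skew-symmetric, i.e. an $f$-structure; it is sPHH (strongly pseudo-horizontally homothetic) if it is PHWC and $\mathscr H\nabla_X(F^\varphi Y)=F^\varphi(\nabla_XY)$ for every vector field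 $X$ and every horizontal vector field $Y$, $\nabla$ being the Levi-Civita connection. Here $U$ carries the flat metric $h$.
   Formalization: For disconnected fibres, Ω need not factor, a fibre need not lie in one affine subspace, and σ may depend on x (e.g. z² on ℂ\{0}); these claims are proved on fibre components, ω and σ exist if fibres are connected, and the conclusion is for any ω, σ as described. *)

theory Defs
  imports "HOL-Analysis.Analysis" "HOL-Library.Function_Algebras"
begin

section \<open>Smooth maps on open sets, complex and Kaehler manifolds\<close>

primrec Ck_on :: "nat \<Rightarrow> 'a::euclidean_space set \<Rightarrow> ('a \<Rightarrow> 'c::real_normed_vector) \<Rightarrow> bool" where
  "Ck_on 0 S f = continuous_on S f"
| "Ck_on (Suc k) S f \<longleftrightarrow>
     (\<forall>x\<in>S. f differentiable (at x)) \<and> (\<forall>v. Ck_on k S (\<lambda>x. frechet_derivative f (at x) v))"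

text \<open>Only used on open sets \<open>S\<close>.\<close>

definition smooth_on :: "'a::euclidean_space set \<Rightarrow> ('a \<Rightarrow> 'c::real_normed_vector) \<Rightarrow> bool" where
  "smooth_on S f \<longleftrightarrow> (\<forall>k. Ck_on k S f)"

text \<open>Holomorphic maps of several variables: complex differentiable at every point of an open set.\<close>

definition cholomorphic_on :: "(complex^'n::finite \<Rightarrow> complex^'k::finite) \<Rightarrow> (complex^'n) set \<Rightarrow> bool" where
  "cholomorphic_on f S \<longleftrightarrow>
     (\<forall>z\<in>S. \<exists>L. (f has_derivative L) (at z) \<and> (\<forall>a v. L (a *s v) = a *s L v))"

text \<open>A chart is a coordinate map together with its domain. A complex manifold of dimension
  \<open>CARD('n)\<close> is a Hausdorff, second countable type \<open>'b\<close> with a (not necessarily maximal)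
  holomorphic atlas.\<close>

type_synonym ('b, 'n) chart = "'b set \<times> ('b \<Rightarrow> complex^'n)"

definition transition :: "('b, 'n::finite) chart \<Rightarrow> ('b, 'n) chart \<Rightarrow> complex^'n \<Rightarrow> complex^'n" where
  "transition C C' = snd C' \<circ> inv_into (fst C) (snd C)"

definition complex_atlas :: "('b::topological_space, 'n::finite) chart set \<Rightarrow> bool" where
  "complex_atlas A \<longleftrightarrow>
     (\<Union>C\<in>A. fst C) = UNIV \<and>
     (\<forall>(D, c)\<in>A. open D \<and> open (c ` D) \<and> homeomorphism D (c ` D) c (inv_into D c)) \<and>
     (\<forall>C\<in>A. \<forall>C'\<in>A. cholomorphic_on (transition C C') (snd C ` (fst C \<inter> fst C')))"

definition holomorphic_map_on ::
  "('b::topological_space, 'n::finite) chart set \<Rightarrow> 'b set \<Rightarrow> ('b \<Rightarrow> complex^'k::finite) \<Rightarrow> bool" where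
  "holomorphic_map_on A W f \<longleftrightarrow> (\<forall>(D, c)\<in>A. cholomorphic_on (f \<circ> inv_into D c) (c ` (D \<inter> W)))"

text \<open>\<open>g C y u v\<close> is the Riemannian metric at \<open>y\<close>, evaluated on the tangent vectors whose
  components in the chart \<open>C\<close> are \<open>u\<close> and \<open>v\<close>.\<close>

type_synonym ('b, 'n) metric = "('b, 'n) chart \<Rightarrow> 'b \<Rightarrow> complex^'n \<Rightarrow> complex^'n \<Rightarrow> real"

definition hermitian_metric ::
  "('b::topological_space, 'n::finite) chart set \<Rightarrow> ('b, 'n) metric \<Rightarrow> bool" where
  "hermitian_metric A g \<longleftrightarrow>
     (\<forall>C\<in>A. \<forall>y\<in>fst C.
        bilinear (g C y) \<and>
        (\<forall>u v. g C y u v = g C y v u) \<and>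
        (\<forall>u. u \<noteq> 0 \<longrightarrow> g C y u u > 0) \<and>
        (\<forall>u v. g C y (\<i> *s u) (\<i> *s v) = g C y u v)) \<and>
     (\<forall>C\<in>A. \<forall>u v. smooth_on (snd C ` fst C) (\<lambda>z. g C (inv_into (fst C) (snd C) z) u v)) \<and>
     (\<forall>C\<in>A. \<forall>C'\<in>A. \<forall>y\<in>fst C \<inter> fst C'. \<forall>u v.
        (let T = frechet_derivative (transition C C') (at (snd C y))
         in g C' y (T u) (T v) = g C y u v))"

definition kaehler_form ::
  "('b, 'n::finite) metric \<Rightarrow> ('b, 'n) chart \<Rightarrow> complex^'n \<Rightarrow> complex^'n \<Rightarrow> complex^'n \<Rightarrow> real" where
  "kaehler_form g C z u v = g C (inv_into (fst C) (snd C) z) (\<i> *s u) v"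

text \<open>The last condition is the vanishing of the exterior derivative of the Kaehler form,
  evaluated on coordinate (constant) vector fields.\<close>

definition kaehler_manifold ::
  "('b::topological_space, 'n::finite) chart set \<Rightarrow> ('b, 'n) metric \<Rightarrow> bool" where
  "kaehler_manifold A g \<longleftrightarrow> complex_atlas A \<and> hermitian_metric A g \<and>
     (\<forall>C\<in>A. \<forall>z\<in>snd C ` fst C. \<forall>u v w.
        frechet_derivative (\<lambda>z. kaehler_form g C z v w) (at z) u
      - frechet_derivative (\<lambda>z. kaehler_form g C z u w) (at z) v
      + frechet_derivative (\<lambda>z. kaehler_form g C z u v) (at z) w = 0)"


section \<open>Submersions of open subsets of a Euclidean space to a complex manifold\<close>

definition smooth_map ::
  "('b::topological_space, 'n::finite) chart set \<Rightarrow> 'a::euclidean_space set \<Rightarrow> ('a \<Rightarrow> 'b) \<Rightarrow> bool" where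
  "smooth_map A U \<phi> \<longleftrightarrow> continuous_on U \<phi> \<and> (\<forall>(D, c)\<in>A. smooth_on (U \<inter> \<phi> -` D) (c \<circ> \<phi>))"

definition submersion ::
  "('b::topological_space, 'n::finite) chart set \<Rightarrow> 'a::euclidean_space set \<Rightarrow> ('a \<Rightarrow> 'b) \<Rightarrow> bool" where
  "submersion A U \<phi> \<longleftrightarrow> smooth_map A U \<phi> \<and>
     (\<forall>x\<in>U. \<forall>(D, c)\<in>A. \<phi> x \<in> D \<longrightarrow> surj (frechet_derivative (c \<circ> \<phi>) (at x)))"

text \<open>The kernel of the differential; it does not depend on the chart around \<open>\<phi> x\<close>.\<close>

definition vertical ::
  "('b, 'n::finite) chart set \<Rightarrow> ('a::euclidean_space \<Rightarrow> 'b) \<Rightarrow> 'a \<Rightarrow> 'a set" where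
  "vertical A \<phi> x = {v. \<forall>(D, c)\<in>A. \<phi> x \<in> D \<longrightarrow> frechet_derivative (c \<circ> \<phi>) (at x) v = 0}"

definition horizontal ::
  "('b, 'n::finite) chart set \<Rightarrow> ('a::euclidean_space \<Rightarrow> 'b) \<Rightarrow> 'a \<Rightarrow> 'a set" where
  "horizontal A \<phi> x = orthogonal_comp (vertical A \<phi> x)"

definition horizontal_part ::
  "('b, 'n::finite) chart set \<Rightarrow> ('a::euclidean_space \<Rightarrow> 'b) \<Rightarrow> 'a \<Rightarrow> 'a \<Rightarrow> 'a" where
  "horizontal_part A \<phi> x w = (THE h. h \<in> horizontal A \<phi> x \<and> w - h \<in> vertical A \<phi> x)"

text \<open>The endomorphism \<open>F\<^sup>\<phi>\<close> at the point \<open>x\<close>; in a chart the complex structure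
  of the target is multiplication by \<open>\<i>\<close>.\<close>

definition induced_F ::
  "('b, 'n::finite) chart set \<Rightarrow> ('a::euclidean_space \<Rightarrow> 'b) \<Rightarrow> 'a \<Rightarrow> 'a \<Rightarrow> 'a" where
  "induced_F A \<phi> x = (THE F. linear F \<and>
     (\<forall>v\<in>vertical A \<phi> x. F v = 0) \<and>
     F ` horizontal A \<phi> x \<subseteq> horizontal A \<phi> x \<and>
     (\<forall>(D, c)\<in>A. \<phi> x \<in> D \<longrightarrow>
        (\<forall>v. frechet_derivative (c \<circ> \<phi>) (at x) (F v) = \<i> *s frechet_derivative (c \<circ> \<phi>) (at x) v)))"

definition PHWC ::
  "('b::topological_space, 'n::finite) chart set \<Rightarrow> 'a::euclidean_space set \<Rightarrow> ('a \<Rightarrow> 'b) \<Rightarrow> bool" where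
  "PHWC A U \<phi> \<longleftrightarrow>
     (\<forall>x\<in>U. \<forall>v w. induced_F A \<phi> x v \<bullet> w = - (v \<bullet> induced_F A \<phi> x w))"

text \<open>The Levi-Civita connection of the flat metric is the directional derivative.\<close>

definition nabla :: "('a::euclidean_space \<Rightarrow> 'a) \<Rightarrow> ('a \<Rightarrow> 'a) \<Rightarrow> 'a \<Rightarrow> 'a" where
  "nabla X Y x = frechet_derivative Y (at x) (X x)"

definition sPHH ::
  "('b::topological_space, 'n::finite) chart set \<Rightarrow> 'a::euclidean_space set \<Rightarrow> ('a \<Rightarrow> 'b) \<Rightarrow> bool" where
  "sPHH A U \<phi> \<longleftrightarrow> PHWC A U \<phi> \<and>
     (\<forall>X Y. smooth_on U X \<longrightarrow> smooth_on U Y \<longrightarrow> (\<forall>x\<in>U. Y x \<in> horizontal A \<phi> x) \<longrightarrow>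
        (\<forall>x\<in>U. horizontal_part A \<phi> x (nabla X (\<lambda>x. induced_F A \<phi> x (Y x)) x)
              = induced_F A \<phi> x (nabla X Y x)))"

text \<open>Vanishing of the second fundamental form of the fibres.\<close>

definition totally_geodesic_fibres ::
  "('b::topological_space, 'n::finite) chart set \<Rightarrow> 'a::euclidean_space set \<Rightarrow> ('a \<Rightarrow> 'b) \<Rightarrow> bool" where
  "totally_geodesic_fibres A U \<phi> \<longleftrightarrow>
     (\<forall>X Y. smooth_on U X \<longrightarrow> smooth_on U Y \<longrightarrow>
        (\<forall>x\<in>U. X x \<in> vertical A \<phi> x \<and> Y x \<in> vertical A \<phi> x) \<longrightarrow>
        (\<forall>x\<in>U. nabla X Y x \<in> vertical A \<phi> x))"

definition fibre :: "'a set \<Rightarrow> ('a \<Rightarrow> 'b) \<Rightarrow> 'b \<Rightarrow> 'a set" where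
  "fibre U \<phi> y = {x\<in>U. \<phi> x = y}"


section \<open>The orthogonal Grassmannian and its universal quotient bundle\<close>

text \<open>Restriction to \<open>V\<close> identifies the complex dual of the complexification of \<open>V\<close> with the
  complex vector space of real-linear functions from \<open>V\<close> to the complex numbers; the elements
  of the Grassmannian are complex subspaces of that space.\<close>

definition cscale :: "complex \<Rightarrow> ('a \<Rightarrow> complex) \<Rightarrow> 'a \<Rightarrow> complex" where
  "cscale a l = (\<lambda>v. a * l v)"

global_interpretation cdual: vector_space cscale
  defines cdual_dim = cdual.dim and cdual_subspace = cdual.subspace
  by unfold_locales (auto simp: cscale_def fun_eq_iff algebra_simps)

text \<open>The complex bilinear extension of the inner product on the dual of \<open>V\<close>.\<close>

definition hC :: "('a::euclidean_space \<Rightarrow> complex) \<Rightarrow> ('a \<Rightarrow> complex) \<Rightarrow> complex" where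
  "hC l l' = (\<Sum>b\<in>Basis. l b * l' b)"

definition orth_grassmannian :: "nat \<Rightarrow> ('a::euclidean_space \<Rightarrow> complex) set set" where
  "orth_grassmannian n = {L. (\<forall>l\<in>L. linear l) \<and> cdual_subspace L \<and> cdual_dim L = n \<and>
     (\<forall>l\<in>L. \<forall>l'\<in>L. hC l l' = 0)}"

text \<open>A quotient of \<open>V\<close> is represented by its kernel \<open>K\<close>; its elements are the cosets of \<open>K\<close>.
  Since \<open>quot_map K\<close> is onto, a map \<open>t\<close> on \<open>V/K\<close> is linear iff \<open>t \<circ> quot_map K\<close> is.\<close>

definition quot_map :: "'a::euclidean_space set \<Rightarrow> 'a \<Rightarrow> 'a set" where
  "quot_map K v = (\<lambda>k. v + k) ` K"

definition quot_space :: "'a::euclidean_space set \<Rightarrow> 'a set set" where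
  "quot_space K = range (quot_map K)"

definition complex_structure_on_quot :: "'a::euclidean_space set \<Rightarrow> ('a set \<Rightarrow> 'a set) \<Rightarrow> bool" where
  "complex_structure_on_quot K J \<longleftrightarrow>
     (\<exists>j. linear j \<and> (\<forall>v. J (quot_map K v) = quot_map K (j v))) \<and>
     (\<forall>v. J (J (quot_map K v)) = quot_map K (- v))"

text \<open>The dual inclusion of the complex quotient \<open>(V/K, J)\<close>: its complex-linear functionals,
  pulled back to \<open>V\<close>.\<close>

definition quot_dual :: "'a::euclidean_space set \<Rightarrow> ('a set \<Rightarrow> 'a set) \<Rightarrow> ('a \<Rightarrow> complex) set" where
  "quot_dual K J = {l \<circ> quot_map K | l. linear (l \<circ> quot_map K) \<and> (\<forall>e\<in>quot_space K. l (J e) = \<i> * l e)}"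

definition isotropic_quotient :: "nat \<Rightarrow> 'a::euclidean_space set \<Rightarrow> ('a set \<Rightarrow> 'a set) \<Rightarrow> bool" where
  "isotropic_quotient n K J \<longleftrightarrow> subspace K \<and> dim K + 2 * n = DIM('a) \<and>
     complex_structure_on_quot K J \<and> quot_dual K J \<in> orth_grassmannian n"

text \<open>The point of the Grassmannian corresponding to a skew-symmetric endomorphism \<open>F\<close>
  with \<open>F\<^sup>3 + F = 0\<close>: the dual inclusion of \<open>V/ker F\<close> with the complex structure induced by \<open>F\<close>.\<close>

definition grass_point :: "('a::euclidean_space \<Rightarrow> 'a) \<Rightarrow> ('a \<Rightarrow> complex) set" where
  "grass_point F = quot_dual {v. F v = 0} (\<lambda>e. {w. \<exists>v\<in>e. F (w - F v) = 0})"

text \<open>The fibre over \<open>L\<close> of the universal quotient is the quotient of the complexification of \<open>V\<close>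
  by the annihilator of \<open>L\<close>. As \<open>V\<close> maps onto it, its realification is \<open>V\<close> modulo the
  real kernel of \<open>L\<close>, and the class of \<open>w\<close> is \<open>\<i>\<close> times that of \<open>v\<close> iff
  \<open>l w = \<i> * l v\<close> for all \<open>l\<close> in \<open>L\<close>.\<close>

definition univ_kernel :: "('a::euclidean_space \<Rightarrow> complex) set \<Rightarrow> 'a set" where
  "univ_kernel L = {v. \<forall>l\<in>L. l v = 0}"

definition univ_J :: "('a::euclidean_space \<Rightarrow> complex) set \<Rightarrow> 'a set \<Rightarrow> 'a set" where
  "univ_J L e = {w. \<exists>v\<in>e. \<forall>l\<in>L. l w = \<i> * l v}"


section \<open>Holomorphic isotropic quotient bundles\<close>

text \<open>A quotient bundle of \<open>N \<times> V\<close> is given by the kernels \<open>K y\<close> of the quotient maps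
  from \<open>V\<close> to the fibres over \<open>y\<close>, its almost complex structure by \<open>J y\<close>.
  A holomorphic trivialization over \<open>W\<close> is a fibrewise complex-linear isomorphism \<open>t\<close> for which
  the induced map from \<open>W \<times> V\<close> is holomorphic in the variable of \<open>W\<close>.\<close>

definition hol_trivialization ::
  "('b::topological_space, 'n::finite) chart set \<Rightarrow> ('b \<Rightarrow> 'a::euclidean_space set) \<Rightarrow>
   ('b \<Rightarrow> 'a set \<Rightarrow> 'a set) \<Rightarrow> 'b set \<Rightarrow> ('b \<Rightarrow> 'a set \<Rightarrow> complex^'k::finite) \<Rightarrow> bool" where
  "hol_trivialization A K J W t \<longleftrightarrow> open W \<and>
     (\<forall>y\<in>W. linear (t y \<circ> quot_map (K y)) \<and> bij_betw (t y) (quot_space (K y)) UNIV \<and>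
        (\<forall>e\<in>quot_space (K y). t y (J y e) = \<i> *s t y e)) \<and>
     (\<forall>v. holomorphic_map_on A W (\<lambda>y. t y (quot_map (K y) v)))"

definition holomorphic_isotropic_quotient ::
  "'k::finite itself \<Rightarrow> ('b::topological_space, 'n::finite) chart set \<Rightarrow>
   ('b \<Rightarrow> 'a::euclidean_space set) \<Rightarrow> ('b \<Rightarrow> 'a set \<Rightarrow> 'a set) \<Rightarrow> bool" where
  "holomorphic_isotropic_quotient (_ :: 'k itself) A K J \<longleftrightarrow>
     (\<forall>y. isotropic_quotient CARD('k) (K y) (J y)) \<and>
     (\<forall>y. \<exists>W (t :: 'b \<Rightarrow> 'a set \<Rightarrow> complex^'k). y \<in> W \<and> hol_trivialization A K J W t)"

text \<open>The holomorphic structure is the one for which the quotient map is holomorphic, so a section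
  is holomorphic iff it is so in all holomorphic trivializations.\<close>

definition holomorphic_section ::
  "'k::finite itself \<Rightarrow> ('b::topological_space, 'n::finite) chart set \<Rightarrow>
   ('b \<Rightarrow> 'a::euclidean_space set) \<Rightarrow> ('b \<Rightarrow> 'a set \<Rightarrow> 'a set) \<Rightarrow> ('b \<Rightarrow> 'a set) \<Rightarrow> bool" where
  "holomorphic_section (_ :: 'k itself) A K J \<sigma> \<longleftrightarrow>
     (\<forall>y. \<sigma> y \<in> quot_space (K y)) \<and>
     (\<forall>W (t :: 'b \<Rightarrow> 'a set \<Rightarrow> complex^'k). hol_trivialization A K J W t \<longrightarrow>
        holomorphic_map_on A W (\<lambda>y. t y (\<sigma> y)))"


section \<open>The data associated with a submersion\<close>

definition Omega ::
  "('b, 'n::finite) chart set \<Rightarrow> ('a::euclidean_space \<Rightarrow> 'b) \<Rightarrow> 'a \<Rightarrow> ('a \<Rightarrow> complex) set" where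
  "Omega A \<phi> x = grass_point (induced_F A \<phi> x)"

text \<open>The pullback of the universal quotient bundle by \<open>\<omega>\<close> with its complex structure
  and its quotient map from \<open>N \<times> V\<close>.\<close>

definition Q_kernel :: "('b \<Rightarrow> ('a::euclidean_space \<Rightarrow> complex) set) \<Rightarrow> 'b \<Rightarrow> 'a set" where
  "Q_kernel \<omega> y = univ_kernel (\<omega> y)"

definition Q_J :: "('b \<Rightarrow> ('a::euclidean_space \<Rightarrow> complex) set) \<Rightarrow> 'b \<Rightarrow> 'a set \<Rightarrow> 'a set" where
  "Q_J \<omega> y = univ_J (\<omega> y)"

definition Q_tau :: "('b \<Rightarrow> ('a::euclidean_space \<Rightarrow> complex) set) \<Rightarrow> 'b \<Rightarrow> 'a \<Rightarrow> 'a set" where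
  "Q_tau \<omega> y v = quot_map (Q_kernel \<omega> y) v"

definition factors_Omega ::
  "('b, 'n::finite) chart set \<Rightarrow> 'a::euclidean_space set \<Rightarrow> ('a \<Rightarrow> 'b) \<Rightarrow>
   ('b \<Rightarrow> ('a \<Rightarrow> complex) set) \<Rightarrow> bool" where
  "factors_Omega A U \<phi> \<omega> \<longleftrightarrow> (\<forall>x\<in>U. Omega A \<phi> x = \<omega> (\<phi> x))"

definition position_section ::
  "'a::euclidean_space set \<Rightarrow> ('a \<Rightarrow> 'b) \<Rightarrow> ('b \<Rightarrow> ('a \<Rightarrow> complex) set) \<Rightarrow> ('b \<Rightarrow> 'a set) \<Rightarrow> bool" where
  "position_section U \<phi> \<omega> \<sigma> \<longleftrightarrow> (\<forall>x\<in>U. \<sigma> (\<phi> x) = Q_tau \<omega> (\<phi> x) x)"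

end

theory Submission
  imports Defs
begin

text \<open>
  Fix \<open>x\<close> in \<open>U\<close>, write \<open>T = d\<phi>\<close> in a chart of the target, \<open>F\<close> for the induced \<open>f\<close>-structure and
  \<open>P = - F\<^sup>2\<close> for the orthogonal projection onto the horizontal space. By definition \<open>T F = \<i> T\<close>. Since \<open>F\<close> is
  skew, \<open>T T\<^sup>*\<close> is complex linear, and \<open>F = T\<^sup>* (T T\<^sup>*)\<^sup>-\<^sup>1 \<i> T\<close> is a smooth function of the point
  (\<open>smooth_F\<close>). The functionals \<open>l\<close> with \<open>l F = \<i> l\<close> have the components of \<open>T\<close> as a basis, and skewness
  makes them isotropic (\<open>hC_complex_functionals\<close>): this is the point \<open>\<Omega> x\<close> of the orthogonal Grassmannian.

  Totally geodesic fibres mean that \<open>P (D\<^sub>u P) = 0\<close> for vertical \<open>u\<close>. As \<open>P\<close> is a field of orthogonal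
  projections, this forces \<open>D\<^sub>u P = 0\<close> (\<open>DP_vertical\<close>). The sPHH condition reads \<open>P (D\<^sub>X F) = F (D\<^sub>X P)\<close> for
  every \<open>X\<close> (\<open>P_DF\<close>), and then also \<open>D\<^sub>u F = 0\<close> for vertical \<open>u\<close>. A Gronwall argument shows that a
  straight segment that starts in a vertical direction stays vertical, so it lies in a fibre and \<open>F\<close> is
  constant along it; local injectivity of \<open>\<phi>\<close> transversally to the vertical space gives the converse. Thus
  the fibre through \<open>x\<close> is locally the affine space \<open>x + ker d\<phi>\<close> (\<open>fibre_locally_affine\<close>), from which the
  statements about the components of the fibres follow.

  For holomorphy, differentiate \<open>T F = \<i> T\<close> along \<open>X\<close> and apply it to a horizontal vector \<open>Y\<close>. The term
  \<open>T (D\<^sub>X F) Y = \<i> T (D\<^sub>X P) Y\<close> vanishes, so the Hessian \<open>B(X, Y) = (D\<^sub>X T) Y\<close> satisfies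
  \<open>B(X, F Y) = \<i> B(X, Y)\<close>. By symmetry of second derivatives, \<open>B(F X, Y) = \<i> B(X, Y)\<close> for horizontal \<open>X\<close>
  and every \<open>Y\<close> (\<open>hessian_complex_linear_left\<close>). Hence the entries of \<open>T\<close> satisfy the Cauchy--Riemann
  equations in the horizontal directions. A function on the target is holomorphic as soon as its
  composition with \<open>\<phi>\<close> satisfies these equations (\<open>holomorphic_map_onI\<close>). The entries of \<open>T\<close> themselves do not descend
  to the target, but \<open>T\<close> normalized to fixed values on a frame of \<open>n\<close> constant vectors does, as it is
  determined by the point of the Grassmannian. It is obtained from \<open>T\<close> by Cramer's rule, so the
  Cauchy--Riemann equations persist, and it is a holomorphic trivialization of the quotient bundle
  (\<open>hol_trivialization_frame\<close>). In any holomorphic trivialization \<open>t\<close>, the section \<open>\<sigma>\<close> pulls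
  back to \<open>x \<mapsto> t\<^bsub>\<phi> x\<^esub> x\<close>, whose derivative is complex linear in the
  horizontal directions because \<open>t\<close> is holomorphic in its index and complex linear in its argument.
\<close>

section \<open>Calculus of $C^k$ maps\<close>

lemma Ck_on_cong:
  assumes "open S" "\<And>x. x \<in> S \<Longrightarrow> f x = g x"
  shows "Ck_on k S f \<longleftrightarrow> Ck_on k S g"
  using assms(2)
proof (induction k arbitrary: f g)
  case 0
  then show ?case by (auto intro: continuous_on_cong)
next
  case (Suc k)
  have ev: "\<forall>\<^sub>F y in nhds x. f y = g y" if "x \<in> S" for x
    using eventually_nhds Suc.prems that \<open>open S\<close> by blast
  have d: "(f has_derivative D) (at x) \<longleftrightarrow> (g has_derivative D) (at x)" if "x \<in> S" for x D
    using has_derivative_transform_within_open[OF _ \<open>open S\<close> that] Suc.prems by metis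
  then have "f differentiable (at x) \<longleftrightarrow> g differentiable (at x)"
    "frechet_derivative f (at x) = frechet_derivative g (at x)" if "x \<in> S" for x
    using that by (auto simp: differentiable_def frechet_derivative_def)
  then show ?case
    using Suc.IH[of "\<lambda>x. frechet_derivative f (at x) v" "\<lambda>x. frechet_derivative g (at x) v" for v]
    by auto
qed

lemma Ck_on_imp_continuous_on: "Ck_on k S f \<Longrightarrow> continuous_on S f"
  by (cases k) (auto simp: continuous_at_imp_continuous_on differentiable_imp_continuous_within)

lemma Ck_on_SucD: "Ck_on (Suc k) S f \<Longrightarrow> Ck_on k S f"
proof (induction k arbitrary: f)
  case 0
  then show ?case using Ck_on_imp_continuous_on by fastforce
next
  case (Suc k)
  then show ?case by (simp del: Ck_on.simps(2) add: Ck_on.simps(2)[of "Suc k"])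
      (auto simp: Ck_on.simps(2)[of k])
qed

lemma Ck_on_local:
  assumes "\<And>x. x \<in> S \<Longrightarrow> \<exists>T. open T \<and> x \<in> T \<and> Ck_on k (S \<inter> T) f"
  shows "Ck_on k S f"
  using assms
proof (induction k arbitrary: f)
  case 0
  show ?case
    unfolding Ck_on.simps continuous_on_eq_continuous_within
  proof
    fix x assume "x \<in> S"
    then obtain T where T: "open T" "x \<in> T" "continuous_on (S \<inter> T) f" using 0 by auto
    then have "continuous (at x within S \<inter> T) f"
      using \<open>x \<in> S\<close> by (simp add: continuous_on_eq_continuous_within)
    moreover have "at x within S \<inter> T = at x within S"
      using T by (intro at_within_nhd[of x T]) auto
    ultimately show "continuous (at x within S) f" by simp
  qed
next
  case (Suc k)
  then show ?case by fastforce
qed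

lemma Ck_on_const: "Ck_on k S (\<lambda>x. c)"
  by (induction k arbitrary: c) auto

lemma Ck_on_SucI:
  assumes "open S" "\<And>x. x \<in> S \<Longrightarrow> (f has_derivative f' x) (at x)" "\<And>v. Ck_on k S (\<lambda>x. f' x v)"
  shows "Ck_on (Suc k) S f"
proof -
  have "frechet_derivative f (at x) v = f' x v" if "x \<in> S" for x v
    using frechet_derivative_at[OF assms(2)[OF that]] by simp
  then have "Ck_on k S (\<lambda>x. frechet_derivative f (at x) v)" for v
    using assms(3)[of v] Ck_on_cong[OF \<open>open S\<close>, of "\<lambda>x. frechet_derivative f (at x) v" "\<lambda>x. f' x v" k]
    by blast
  then show ?thesis using assms(2) by (auto simp: differentiable_def)
qed

lemma Ck_on_SucE:
  assumes "Ck_on (Suc k) S f"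
  shows "x \<in> S \<Longrightarrow> (f has_derivative frechet_derivative f (at x)) (at x)"
    and "Ck_on k S (\<lambda>x. frechet_derivative f (at x) v)"
  using assms by (auto simp: frechet_derivative_works)

lemma Ck_on_add:
  assumes "open S" "Ck_on k S f" "Ck_on k S g"
  shows "Ck_on k S (\<lambda>x. f x + g x)"
  using assms(2,3)
proof (induction k arbitrary: f g)
  case 0
  then show ?case by (auto intro: continuous_intros)
next
  case (Suc k)
  show ?case
    using Suc by (intro Ck_on_SucI[OF \<open>open S\<close> has_derivative_add] Suc.IH)
      (auto simp: frechet_derivative_works)
qed

lemma Ck_on_bilinear:
  fixes pr :: "'b::real_normed_vector \<Rightarrow> 'c::real_normed_vector \<Rightarrow> 'd::real_normed_vector"
  assumes "open S" "bounded_bilinear pr" "Ck_on k S f" "Ck_on k S g"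
  shows "Ck_on k S (\<lambda>x. pr (f x) (g x))"
  using assms(3,4)
proof (induction k arbitrary: f g)
  case 0
  then show ?case by (auto intro: bounded_bilinear.continuous_on[OF assms(2)])
next
  case (Suc k)
  interpret bounded_bilinear pr by fact
  show ?case
    using Ck_on_SucE[OF Suc.prems(1)] Ck_on_SucE[OF Suc.prems(2)] Ck_on_SucD[OF Suc.prems(1)]
      Ck_on_SucD[OF Suc.prems(2)]
    by (intro Ck_on_SucI[OF \<open>open S\<close> FDERIV] Ck_on_add \<open>open S\<close> Suc.IH)
qed

lemma Ck_on_bounded_linear:
  assumes "open S" "bounded_linear L" "Ck_on k S f"
  shows "Ck_on k S (\<lambda>x. L (f x))"
proof -
  have "bounded_bilinear (\<lambda>(r::real) y. r *\<^sub>R L y)"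
    by (rule bounded_bilinear.comp[OF bounded_bilinear_scaleR bounded_linear_ident assms(2)])
  from Ck_on_bilinear[OF assms(1) this Ck_on_const[of k S 1] assms(3)] show ?thesis by simp
qed

lemma Ck_on_inverse:
  fixes f :: "'a::euclidean_space \<Rightarrow> 'c::real_normed_field"
  assumes "open S" "Ck_on k S f" "\<And>x. x \<in> S \<Longrightarrow> f x \<noteq> 0"
  shows "Ck_on k S (\<lambda>x. inverse (f x))"
  using assms(2)
proof (induction k)
  case 0
  then show ?case using assms(3) by (auto intro: continuous_intros)
next
  case (Suc k)
  show ?case
    using Ck_on_SucE[OF Suc.prems] Suc.IH[OF Ck_on_SucD[OF Suc.prems]] assms(3)
    by (intro Ck_on_SucI[OF \<open>open S\<close>
          Deriv.has_derivative_inverse[where f' = "frechet_derivative f (at x)" for x]]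
        Ck_on_bounded_linear[of S uminus, OF \<open>open S\<close> bounded_linear_minus[OF bounded_linear_ident]]
        Ck_on_bilinear[OF \<open>open S\<close> bounded_bilinear_mult]) auto
qed

lemma smooth_on_const: "smooth_on S (\<lambda>x. c)"
  unfolding smooth_on_def by (intro allI Ck_on_const)

lemma smooth_on_add:
  "open S \<Longrightarrow> smooth_on S f \<Longrightarrow> smooth_on S g \<Longrightarrow> smooth_on S (\<lambda>x. f x + g x)"
  unfolding smooth_on_def by (intro allI Ck_on_add[where f = f and g = g]) auto

lemma smooth_on_bilinear:
  "open S \<Longrightarrow> bounded_bilinear pr \<Longrightarrow> smooth_on S f \<Longrightarrow> smooth_on S g \<Longrightarrow>
    smooth_on S (\<lambda>x. pr (f x) (g x))"
  unfolding smooth_on_def by (intro allI Ck_on_bilinear[where pr = pr and f = f and g = g]) auto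

lemma smooth_on_bounded_linear:
  "open S \<Longrightarrow> bounded_linear L \<Longrightarrow> smooth_on S f \<Longrightarrow> smooth_on S (\<lambda>x. L (f x))"
  unfolding smooth_on_def by (intro allI Ck_on_bounded_linear[where L = L and f = f]) auto

lemma smooth_on_inverse:
  fixes f :: "'a::euclidean_space \<Rightarrow> 'c::real_normed_field"
  shows "open S \<Longrightarrow> smooth_on S f \<Longrightarrow> (\<And>x. x \<in> S \<Longrightarrow> f x \<noteq> 0) \<Longrightarrow> smooth_on S (\<lambda>x. inverse (f x))"
  unfolding smooth_on_def by (intro allI Ck_on_inverse[where f = f]) auto

lemma smooth_on_cong:
  "open S \<Longrightarrow> (\<And>x. x \<in> S \<Longrightarrow> f x = g x) \<Longrightarrow> smooth_on S f \<longleftrightarrow> smooth_on S g"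
  unfolding smooth_on_def using Ck_on_cong by blast

lemma smooth_on_local:
  assumes "\<And>x. x \<in> S \<Longrightarrow> \<exists>T. open T \<and> x \<in> T \<and> smooth_on (S \<inter> T) f"
  shows "smooth_on S f"
  unfolding smooth_on_def
proof
  fix k show "Ck_on k S f"
  proof (rule Ck_on_local)
    fix x assume "x \<in> S"
    from assms[OF this] show "\<exists>T. open T \<and> x \<in> T \<and> Ck_on k (S \<inter> T) f"
      unfolding smooth_on_def by meson
  qed
qed

lemma smooth_on_sum:
  assumes "open S" "\<And>i. i \<in> I \<Longrightarrow> smooth_on S (f i)"
  shows "smooth_on S (\<lambda>x. \<Sum>i\<in>I. f i x)"
  using assms(2)
proof (induction I rule: infinite_finite_induct)
  case (insert i I)
  then show ?case
    using smooth_on_add[OF \<open>open S\<close>, of "f i" "\<lambda>x. \<Sum>i\<in>I. f i x"] by simp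
qed (simp_all add: smooth_on_const)

lemma smooth_on_prod:
  fixes f :: "'i \<Rightarrow> 'a::euclidean_space \<Rightarrow> 'c::real_normed_field"
  assumes "open S" "\<And>i. i \<in> I \<Longrightarrow> smooth_on S (f i)"
  shows "smooth_on S (\<lambda>x. \<Prod>i\<in>I. f i x)"
  using assms(2)
proof (induction I rule: infinite_finite_induct)
  case (insert i I)
  then show ?case
    using smooth_on_bilinear[OF \<open>open S\<close> bounded_bilinear_mult, of "f i" "\<lambda>x. \<Prod>i\<in>I. f i x"] by simp
qed (simp_all add: smooth_on_const)

lemma smooth_on_differentiable: "smooth_on S f \<Longrightarrow> x \<in> S \<Longrightarrow> f differentiable (at x)"
  by (auto simp: smooth_on_def dest!: spec[of _ "Suc 0"])

lemma smooth_on_has_derivative: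
  "smooth_on S f \<Longrightarrow> x \<in> S \<Longrightarrow> (f has_derivative frechet_derivative f (at x)) (at x)"
  using smooth_on_differentiable frechet_derivative_works by blast

lemma smooth_on_frechet_derivative:
  "smooth_on S f \<Longrightarrow> smooth_on S (\<lambda>x. frechet_derivative f (at x) v)"
  unfolding smooth_on_def by (metis Ck_on.simps(2))

lemma smooth_on_imp_continuous_on: "smooth_on S f \<Longrightarrow> continuous_on S f"
  by (auto simp: smooth_on_def intro: Ck_on_imp_continuous_on)

lemma smooth_on_det:
  fixes M :: "'a::euclidean_space \<Rightarrow> complex^'n^'n"
  assumes "open S" "\<And>i j. smooth_on S (\<lambda>x. M x $ i $ j)"
  shows "smooth_on S (\<lambda>x. det (M x))"
  unfolding det_def
proof (intro smooth_on_sum[OF \<open>open S\<close>])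
  fix p :: "'n \<Rightarrow> 'n"
  have "smooth_on S (\<lambda>x. \<Prod>i\<in>UNIV. M x $ i $ p i)"
    by (intro smooth_on_prod assms)
  from smooth_on_bilinear[OF \<open>open S\<close> bounded_bilinear_mult smooth_on_const this]
  show "smooth_on S (\<lambda>x. of_int (sign p) * (\<Prod>i\<in>UNIV. M x $ i $ p i))" .
qed

text \<open>By the mean value theorem, applied once in each direction, the second difference of \<open>f\<close>
  along \<open>u\<close> and \<open>v\<close> is a value of the iterated directional derivative in either order; the two
  orders agree in the limit because both derivatives are continuous.\<close>

lemma second_difference_mvt:
  fixes f :: "'a::euclidean_space \<Rightarrow> real"
  assumes f: "\<And>y. y \<in> S \<Longrightarrow> (f has_derivative f' y) (at y)"
    and f': "\<And>y. y \<in> S \<Longrightarrow> ((\<lambda>y. f' y v) has_derivative f'' y) (at y)"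
    and S: "\<And>s t. 0 \<le> s \<Longrightarrow> s \<le> h \<Longrightarrow> 0 \<le> t \<Longrightarrow> t \<le> h \<Longrightarrow> x + s *\<^sub>R u + t *\<^sub>R v \<in> S"
    and "h > 0"
  shows "\<exists>s t. 0 < s \<and> s < h \<and> 0 < t \<and> t < h \<and>
    f (x + h *\<^sub>R u + h *\<^sub>R v) - f (x + h *\<^sub>R u) - f (x + h *\<^sub>R v) + f x
      = h * h * f'' (x + s *\<^sub>R u + t *\<^sub>R v) u"
proof -
  define k where "k t = f (x + h *\<^sub>R u + t *\<^sub>R v) - f (x + 0 *\<^sub>R u + t *\<^sub>R v)" for t
  have dk: "(k has_real_derivative f' (x + h *\<^sub>R u + t *\<^sub>R v) v - f' (x + 0 *\<^sub>R u + t *\<^sub>R v) v) (at t)"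
    if "0 \<le> t" "t \<le> h" for t
  proof -
    have "((\<lambda>t. f (x + s *\<^sub>R u + t *\<^sub>R v)) has_derivative (\<lambda>r. f' (x + s *\<^sub>R u + t *\<^sub>R v) (r *\<^sub>R v))) (at t)"
      if "s = h \<or> s = 0" for s
    proof (rule has_derivative_compose[of "\<lambda>t. x + s *\<^sub>R u + t *\<^sub>R v", OF _ f])
      show "((\<lambda>t. x + s *\<^sub>R u + t *\<^sub>R v) has_derivative (\<lambda>r. r *\<^sub>R v)) (at t)"
        by (auto intro!: derivative_eq_intros)
      show "x + s *\<^sub>R u + t *\<^sub>R v \<in> S" using S[of s t] that \<open>0 \<le> t\<close> \<open>t \<le> h\<close> \<open>h > 0\<close> by auto
    qed
    moreover have "f' y (r *\<^sub>R v) = f' y v * r" if "y \<in> S" for y r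
      using linear_scale[OF has_derivative_linear[OF f[OF that]], of r v] by simp
    moreover have "x + s *\<^sub>R u + t *\<^sub>R v \<in> S" if "s = h \<or> s = 0" for s
      using S[of s t] that \<open>0 \<le> t\<close> \<open>t \<le> h\<close> \<open>h > 0\<close> by auto
    ultimately have "((\<lambda>t. f (x + s *\<^sub>R u + t *\<^sub>R v)) has_real_derivative
        f' (x + s *\<^sub>R u + t *\<^sub>R v) v) (at t)" if "s = h \<or> s = 0" for s
      using that by (simp add: has_field_derivative_def)
    from DERIV_diff[OF this[of h] this[of 0]] show ?thesis unfolding k_def by simp
  qed
  obtain t where t: "0 < t" "t < h"
    "k h - k 0 = (h - 0) * (f' (x + h *\<^sub>R u + t *\<^sub>R v) v - f' (x + 0 *\<^sub>R u + t *\<^sub>R v) v)"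
    using MVT2[OF \<open>h > 0\<close> dk] by auto
  define j where "j s = f' (x + s *\<^sub>R u + t *\<^sub>R v) v" for s
  have dj: "(j has_real_derivative f'' (x + s *\<^sub>R u + t *\<^sub>R v) u) (at s)" if "0 \<le> s" "s \<le> h" for s
  proof -
    have inS: "x + s *\<^sub>R u + t *\<^sub>R v \<in> S" using S[of s t] that t by auto
    have "(j has_derivative (\<lambda>r. f'' (x + s *\<^sub>R u + t *\<^sub>R v) (r *\<^sub>R u))) (at s)"
      unfolding j_def
    proof (rule has_derivative_compose[of "\<lambda>s. x + s *\<^sub>R u + t *\<^sub>R v", OF _ f'[OF inS]])
      show "((\<lambda>s. x + s *\<^sub>R u + t *\<^sub>R v) has_derivative (\<lambda>r. r *\<^sub>R u)) (at s)"
        by (auto intro!: derivative_eq_intros)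
    qed
    moreover have "f'' (x + s *\<^sub>R u + t *\<^sub>R v) (r *\<^sub>R u) = f'' (x + s *\<^sub>R u + t *\<^sub>R v) u * r" for r
      using linear_scale[OF has_derivative_linear[OF f'[OF inS]], of r u] by simp
    ultimately show ?thesis by (simp add: has_field_derivative_def)
  qed
  obtain s where s: "0 < s" "s < h" "j h - j 0 = (h - 0) * f'' (x + s *\<^sub>R u + t *\<^sub>R v) u"
    using MVT2[OF \<open>h > 0\<close> dj] by auto
  show ?thesis
    using s t by (intro exI[of _ s] exI[of _ t]) (auto simp: k_def j_def algebra_simps)
qed

lemma second_derivative_symmetric_real:
  fixes f :: "'a::euclidean_space \<Rightarrow> real"
  assumes "open S" "x \<in> S" "smooth_on S f"
  shows "frechet_derivative (\<lambda>y. frechet_derivative f (at y) v) (at x) u =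
         frechet_derivative (\<lambda>y. frechet_derivative f (at y) u) (at x) v"
proof (rule ccontr)
  define B where "B a b y = frechet_derivative (\<lambda>y. frechet_derivative f (at y) a) (at y) b" for a b y
  assume "\<not> ?thesis"
  then have ne: "B v u x \<noteq> B u v x" by (simp add: B_def)
  define e where "e = \<bar>B v u x - B u v x\<bar> / 2"
  have "e > 0" using ne by (simp add: e_def)
  have cont: "continuous_on S (B a b)" for a b
    unfolding B_def using assms(3) by (intro smooth_on_imp_continuous_on smooth_on_frechet_derivative)
  have "\<exists>d>0. \<forall>y. dist y x < d \<longrightarrow> y \<in> S \<and> \<bar>B a b y - B a b x\<bar> < e" for a b
  proof -
    have "isCont (B a b) x" using cont assms by (simp add: continuous_on_eq_continuous_at)
    then obtain d1 where "d1 > 0" "\<And>y. dist y x < d1 \<Longrightarrow> \<bar>B a b y - B a b x\<bar> < e"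
      using \<open>e > 0\<close> unfolding continuous_at_eps_delta dist_real_def by blast
    moreover obtain d2 where "d2 > 0" "\<And>y. dist y x < d2 \<Longrightarrow> y \<in> S"
      using assms unfolding open_dist by blast
    ultimately show ?thesis by (intro exI[of _ "min d1 d2"]) auto
  qed
  then obtain d1 d2 where d1: "d1 > 0" "\<And>y. dist y x < d1 \<Longrightarrow> y \<in> S \<and> \<bar>B v u y - B v u x\<bar> < e"
    and d2: "d2 > 0" "\<And>y. dist y x < d2 \<Longrightarrow> y \<in> S \<and> \<bar>B u v y - B u v x\<bar> < e" by metis
  define h where "h = min d1 d2 / (2 * (norm u + norm v + 1))"
  have pos: "norm u + norm v + 1 > 0" by (simp add: add_nonneg_pos)
  then have h: "h > 0" using d1 d2 by (simp add: h_def)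
  have dist: "dist (x + s *\<^sub>R u + t *\<^sub>R v) x < min d1 d2" if "0 \<le> s" "s \<le> h" "0 \<le> t" "t \<le> h" for s t
  proof -
    have "norm (s *\<^sub>R u + t *\<^sub>R v) \<le> s * norm u + t * norm v"
      using that by (metis abs_of_nonneg norm_scaleR norm_triangle_ineq)
    also have "\<dots> \<le> h * norm u + h * norm v" using that by (intro add_mono mult_right_mono) auto
    also have "\<dots> \<le> h * (norm u + norm v + 1)" using h by (simp add: algebra_simps)
    also have "\<dots> = min d1 d2 / 2"
      unfolding h_def using less_imp_neq[OF pos] by (simp add: field_simps del: of_nat_add)
    also have "\<dots> < min d1 d2" using d1(1) d2(1) by (auto simp: min_def)
    finally show ?thesis by (simp add: dist_norm)
  qed
  have f: "(f has_derivative frechet_derivative f (at y)) (at y)" if "y \<in> S" for y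
    using assms that by (intro smooth_on_has_derivative)
  have f': "((\<lambda>y. frechet_derivative f (at y) a) has_derivative
      (\<lambda>b. B a b y)) (at y)" if "y \<in> S" for y a
    unfolding B_def using assms that by (intro smooth_on_has_derivative smooth_on_frechet_derivative)
  have inS: "x + s *\<^sub>R u + t *\<^sub>R v \<in> S" "x + t *\<^sub>R v + s *\<^sub>R u \<in> S"
    if "0 \<le> s" "s \<le> h" "0 \<le> t" "t \<le> h" for s t
    using dist[OF that] d1 by (auto simp: algebra_simps)
  obtain s t where st: "0 < s" "s < h" "0 < t" "t < h"
    "f (x + h *\<^sub>R u + h *\<^sub>R v) - f (x + h *\<^sub>R u) - f (x + h *\<^sub>R v) + f x
      = h * h * B v u (x + s *\<^sub>R u + t *\<^sub>R v)"
    using second_difference_mvt[of S f "\<lambda>y. frechet_derivative f (at y)" v "\<lambda>y b. B v b y" h x u,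
      OF f f' inS(1) h] by auto
  obtain s' t' where st': "0 < s'" "s' < h" "0 < t'" "t' < h"
    "f (x + h *\<^sub>R v + h *\<^sub>R u) - f (x + h *\<^sub>R v) - f (x + h *\<^sub>R u) + f x
      = h * h * B u v (x + s' *\<^sub>R v + t' *\<^sub>R u)"
    using second_difference_mvt[of S f "\<lambda>y. frechet_derivative f (at y)" u "\<lambda>y b. B u b y" h x v,
      OF f f' inS(2) h] by auto
  have "h * h * B v u (x + s *\<^sub>R u + t *\<^sub>R v) = h * h * B u v (x + s' *\<^sub>R v + t' *\<^sub>R u)"
    using st(5) st'(5) by (simp add: algebra_simps)
  then have eq: "B v u (x + s *\<^sub>R u + t *\<^sub>R v) = B u v (x + t' *\<^sub>R u + s' *\<^sub>R v)"
    using h by (simp add: algebra_simps)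
  have "\<bar>B v u (x + s *\<^sub>R u + t *\<^sub>R v) - B v u x\<bar> < e" "\<bar>B u v (x + t' *\<^sub>R u + s' *\<^sub>R v) - B u v x\<bar> < e"
    using d1(2) d2(2) dist[of s t] dist[of t' s'] st st' by auto
  then show False unfolding eq e_def by (simp add: abs_if split: if_splits)
qed

lemma frechet_derivative_bounded_linear:
  assumes "bounded_linear L" "f differentiable (at x)"
  shows "frechet_derivative (\<lambda>y. L (f y)) (at x) v = L (frechet_derivative f (at x) v)"
  using bounded_linear.has_derivative[OF assms(1)] assms(2)
  by (metis frechet_derivative_at frechet_derivative_works)

lemma second_derivative_symmetric:
  fixes f :: "'a::euclidean_space \<Rightarrow> 'c::euclidean_space"
  assumes "open S" "x \<in> S" "smooth_on S f"
  shows "frechet_derivative (\<lambda>y. frechet_derivative f (at y) v) (at x) u =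
         frechet_derivative (\<lambda>y. frechet_derivative f (at y) u) (at x) v"
proof (rule euclidean_eqI)
  fix b :: 'c assume "b \<in> Basis"
  have bl: "bounded_linear (\<lambda>y. y \<bullet> b)" by (rule bounded_linear_inner_left)
  have "frechet_derivative (\<lambda>y. frechet_derivative f (at y) w) (at x) w' \<bullet> b =
      frechet_derivative (\<lambda>y. frechet_derivative (\<lambda>y. f y \<bullet> b) (at y) w) (at x) w'" for w w'
  proof -
    have "frechet_derivative (\<lambda>y. frechet_derivative f (at y) w) (at x) w' \<bullet> b =
        frechet_derivative (\<lambda>y. frechet_derivative f (at y) w \<bullet> b) (at x) w'"
      using frechet_derivative_bounded_linear[OF bl]
        smooth_on_differentiable[OF smooth_on_frechet_derivative] assms by metis
    also have "\<dots> = frechet_derivative (\<lambda>y. frechet_derivative (\<lambda>y. f y \<bullet> b) (at y) w) (at x) w'"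
    proof -
      have "frechet_derivative (\<lambda>y. frechet_derivative f (at y) w \<bullet> b) (at x) =
         frechet_derivative (\<lambda>y. frechet_derivative (\<lambda>y. f y \<bullet> b) (at y) w) (at x)"
      proof (rule frechet_derivative_transform_within_open[OF _ assms(1,2)])
        show "(\<lambda>y. frechet_derivative f (at y) w \<bullet> b) differentiable at x"
          by (rule smooth_on_differentiable[OF smooth_on_bounded_linear[OF assms(1) bl
                smooth_on_frechet_derivative[OF assms(3)]] assms(2)])
        show "frechet_derivative f (at y) w \<bullet> b = frechet_derivative (\<lambda>y. f y \<bullet> b) (at y) w"
          if "y \<in> S" for y
          using frechet_derivative_bounded_linear[OF bl smooth_on_differentiable[OF assms(3) that]]
          by simp
      qed
      then show ?thesis by simp
    qed
    finally show ?thesis .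
  qed
  then show "frechet_derivative (\<lambda>y. frechet_derivative f (at y) v) (at x) u \<bullet> b =
         frechet_derivative (\<lambda>y. frechet_derivative f (at y) u) (at x) v \<bullet> b"
    using second_derivative_symmetric_real[OF assms(1,2) smooth_on_bounded_linear[OF assms(1) bl assms(3)]]
    by simp
qed

section \<open>Linear algebra of $f$-structures\<close>

lemma scaleR_eq_vec_smult: "r *\<^sub>R (w::complex^'k) = complex_of_real r *s w"
  by (simp add: vec_eq_iff complex_eq_iff)

lemma bounded_linear_vec_smult: "bounded_linear (\<lambda>w::complex^'k. a *s w)"
  by (intro linear_conv_bounded_linear[THEN iffD1] linearI)
    (auto simp: vec_eq_iff algebra_simps)

lemma inner_i_smult: "(\<i> *s (u::complex^'k)) \<bullet> w = - (u \<bullet> (\<i> *s w))"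
  by (simp add: inner_vec_def inner_complex_def flip: sum_negf)

lemma i_smult_i_smult [simp]: "\<i> *s (\<i> *s (u::complex^'k)) = - u"
  by (simp add: vec_eq_iff flip: mult.assoc)

lemma linear_i_imp_complex_linear:
  fixes L :: "complex^'k \<Rightarrow> complex^'l"
  assumes "linear L" "\<And>w. L (\<i> *s w) = \<i> *s L w"
  shows "L (a *s w) = a *s L w"
proof -
  have split: "b *s u = Re b *\<^sub>R u + Im b *\<^sub>R (\<i> *s u)" for b and u :: "complex^'m"
    by (simp add: vec_eq_iff complex_eq_iff)
  show ?thesis
    by (simp add: split[of a] linear_add[OF assms(1)] linear_scale[OF assms(1)] assms(2))
qed

subsection \<open>The horizontal lift of a surjective linear map\<close>

text \<open>The Moore--Penrose right inverse; its range is the orthogonal complement of the kernel.\<close>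

definition horizontal_lift :: "('a::euclidean_space \<Rightarrow> 'c::euclidean_space) \<Rightarrow> 'c \<Rightarrow> 'a" where
  "horizontal_lift T = adjoint T \<circ> inv (T \<circ> adjoint T)"

lemma bij_comp_adjoint:
  fixes T :: "'a::euclidean_space \<Rightarrow> 'c::euclidean_space"
  assumes "linear T" "surj T"
  shows "bij (T \<circ> adjoint T)"
proof -
  have lin: "linear (T \<circ> adjoint T)"
    by (rule linear_compose[OF adjoint_linear[OF assms(1)] assms(1)])
  have "inj (T \<circ> adjoint T)"
    unfolding linear_injective_0[OF lin]
  proof (intro allI impI)
    fix w assume "(T \<circ> adjoint T) w = 0"
    then have "adjoint T w \<bullet> adjoint T w = 0"
      using adjoint_clauses(2)[OF assms(1), of w "adjoint T w"] by simp
    then have "adjoint T w = 0" by simp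
    then have "w \<bullet> T v = 0" for v using adjoint_clauses(2)[OF assms(1), of w v] by simp
    then show "w = 0" using assms(2) by (metis inner_eq_zero_iff surjD)
  qed
  then show ?thesis using linear_injective_imp_surjective[OF lin] by (simp add: bij_def)
qed

lemma horizontal_lift:
  fixes T :: "'a::euclidean_space \<Rightarrow> 'c::euclidean_space"
  assumes "linear T" "surj T"
  shows linear_horizontal_lift: "linear (horizontal_lift T)"
    and horizontal_lift_right_inverse: "T (horizontal_lift T w) = w"
    and horizontal_lift_orthogonal: "T v = 0 \<Longrightarrow> horizontal_lift T w \<bullet> v = 0"
    and horizontal_lift_left_inverse: "(\<And>v. T v = 0 \<Longrightarrow> u \<bullet> v = 0) \<Longrightarrow> horizontal_lift T (T u) = u"
proof -
  have lin: "linear (T \<circ> adjoint T)" by (rule linear_compose[OF adjoint_linear[OF assms(1)] assms(1)])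
  have bij: "bij (T \<circ> adjoint T)" by (rule bij_comp_adjoint[OF assms])
  have "linear (inv (T \<circ> adjoint T))"
    using lin bij by (simp add: bij_is_inj inj_linear_imp_inv_linear)
  then show "linear (horizontal_lift T)"
    unfolding horizontal_lift_def by (rule linear_compose[OF _ adjoint_linear[OF assms(1)]])
  show right: "T (horizontal_lift T w) = w" for w
    using surj_f_inv_f[OF bij_is_surj[OF bij], of w] by (simp add: horizontal_lift_def)
  show orth: "horizontal_lift T w \<bullet> v = 0" if "T v = 0" for v w
    using that by (simp add: horizontal_lift_def adjoint_clauses[OF assms(1)])
  show "horizontal_lift T (T u) = u" if u: "\<And>v. T v = 0 \<Longrightarrow> u \<bullet> v = 0"
  proof -
    let ?d = "u - horizontal_lift T (T u)"
    have "T ?d = 0" by (simp add: linear_diff[OF assms(1)] right)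
    then have "?d \<bullet> ?d = 0" using u orth by (simp add: inner_diff_left)
    then show ?thesis by simp
  qed
qed

lemma horizontal_lift_eq_adjoint:
  fixes T :: "'a::euclidean_space \<Rightarrow> 'c::euclidean_space"
  assumes "linear T" "surj T" "T (adjoint T z) = w"
  shows "horizontal_lift T w = adjoint T z"
  using bij_is_inj[OF bij_comp_adjoint[OF assms(1,2)]] assms(3)
  by (metis comp_apply horizontal_lift_def inv_f_f)

lemma adjoint_eq_sum:
  fixes T :: "'a::euclidean_space \<Rightarrow> 'c::euclidean_space"
  assumes "linear T"
  shows "adjoint T w = (\<Sum>b\<in>Basis. (T b \<bullet> w) *\<^sub>R b)"
proof -
  have "adjoint T w = (\<Sum>b\<in>Basis. (adjoint T w \<bullet> b) *\<^sub>R b)"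
    by (simp add: euclidean_representation)
  then show ?thesis by (simp add: adjoint_clauses[OF assms] inner_commute)
qed

lemma dim_kernel_surj:
  fixes T :: "'a::euclidean_space \<Rightarrow> 'c::euclidean_space"
  assumes "linear T" "surj T"
  shows "dim {v. T v = 0} + DIM('c) = DIM('a)"
proof -
  have sub: "subspace {v. T v = 0}" by (rule linear_subspace_kernel[OF assms(1)])
  have "{y \<in> UNIV. \<forall>v\<in>{v. T v = 0}. orthogonal v y} = range (horizontal_lift T)" (is "?H = _")
  proof safe
    fix y assume "\<forall>v\<in>{v. T v = 0}. orthogonal v y"
    then have "horizontal_lift T (T y) = y"
      by (intro horizontal_lift_left_inverse[OF assms]) (auto simp: orthogonal_def inner_commute)
    then show "y \<in> range (horizontal_lift T)" by (metis rangeI)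
  qed (use horizontal_lift_orthogonal[OF assms] in \<open>auto simp: orthogonal_def inner_commute\<close>)
  moreover have "inj (horizontal_lift T)"
    using horizontal_lift_right_inverse[OF assms] by (metis injI)
  then have "dim (range (horizontal_lift T)) = DIM('c)"
    by (subst dim_image_eq[OF linear_horizontal_lift[OF assms]]) auto
  ultimately show ?thesis
    using dim_subspace_orthogonal_to_vectors[OF sub subspace_UNIV subset_UNIV] by simp
qed

subsection \<open>The complex-linear functionals of a quotient\<close>

definition complex_functionals :: "('a::euclidean_space \<Rightarrow> 'a) \<Rightarrow> ('a \<Rightarrow> complex) set" where
  "complex_functionals j = {l. linear l \<and> (\<forall>v. l (j v) = \<i> * l v)}"

lemma mem_quot_map: "w \<in> quot_map K v \<longleftrightarrow> w - v \<in> K"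
  unfolding quot_map_def by (auto simp: image_iff algebra_simps intro!: bexI[of _ "w - v"])

lemma quot_map_eq_iff:
  assumes "subspace K"
  shows "quot_map K v = quot_map K w \<longleftrightarrow> v - w \<in> K"
proof
  assume "quot_map K v = quot_map K w"
  then show "v - w \<in> K"
    using mem_quot_map[of v K v] mem_quot_map[of v K w] subspace_0[OF assms] by simp
next
  assume d: "v - w \<in> K"
  then have "w - v \<in> K" using subspace_neg[OF assms d] by simp
  then show "quot_map K v = quot_map K w"
    using d subspace_add[OF assms] by (force simp: set_eq_iff mem_quot_map)
qed

lemma quot_map_in_quot_space: "quot_map K v \<in> quot_space K"
  by (simp add: quot_space_def)

text \<open>The functional on the quotient is recovered from its pullback by evaluating at an
  arbitrary representative.\<close>

lemma quot_dual_eq_complex_functionals: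
  assumes K: "subspace K" and J: "\<And>v. J (quot_map K v) = quot_map K (j v)"
    and vanish: "\<And>l v. l \<in> complex_functionals j \<Longrightarrow> v \<in> K \<Longrightarrow> l v = 0"
  shows "quot_dual K J = complex_functionals j"
proof (intro set_eqI iffI)
  fix l assume "l \<in> quot_dual K J"
  then obtain m where m: "l = m \<circ> quot_map K" "linear l" "\<And>e. e \<in> quot_space K \<Longrightarrow> m (J e) = \<i> * m e"
    unfolding quot_dual_def by auto
  have "l (j v) = \<i> * l v" for v
    using m(3)[OF quot_map_in_quot_space, of v] by (simp add: m(1) J)
  then show "l \<in> complex_functionals j" using m by (simp add: complex_functionals_def)
next
  fix l assume l: "l \<in> complex_functionals j"
  then have lin: "linear l" by (simp add: complex_functionals_def)
  define m where "m e = l (SOME v. v \<in> e)" for e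
  have m: "m (quot_map K v) = l v" for v
  proof -
    have "v \<in> quot_map K v" by (simp add: mem_quot_map subspace_0[OF K])
    then have "(SOME w. w \<in> quot_map K v) - v \<in> K" by (metis mem_quot_map someI)
    from vanish[OF l this] show ?thesis by (simp add: m_def linear_diff[OF lin])
  qed
  then have eq: "m \<circ> quot_map K = l" by auto
  moreover have "\<forall>e\<in>quot_space K. m (J e) = \<i> * m e"
    using l by (auto simp: quot_space_def J m complex_functionals_def)
  ultimately show "l \<in> quot_dual K J"
    unfolding quot_dual_def mem_Collect_eq using lin eq by (intro exI[of _ m] conjI) simp_all
qed

text \<open>Skewness of \<open>F\<close> gives \<open>h(l \<circ> F, l') = - h(l, l' \<circ> F)\<close>. For complex-linear functionals the left
  side is \<open>\<i> h(l, l')\<close> and the right side is \<open>- \<i> h(l, l')\<close>.\<close>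

lemma hC_complex_functionals:
  fixes F :: "'a::euclidean_space \<Rightarrow> 'a"
  assumes F: "linear F" "\<And>v w. F v \<bullet> w = - (v \<bullet> F w)"
    and l: "l \<in> complex_functionals F" "l' \<in> complex_functionals F"
  shows "hC l l' = 0"
proof -
  have exp: "f (F b) = (\<Sum>b'\<in>Basis. of_real (F b \<bullet> b') * f b')" if "linear f" for f :: "'a \<Rightarrow> complex" and b
  proof -
    have "f (F b) = f (\<Sum>b'\<in>Basis. (F b \<bullet> b') *\<^sub>R b')" by (simp add: euclidean_representation)
    then show ?thesis
      by (simp add: linear_sum[OF that] linear_scale[OF that] scaleR_conv_of_real)
  qed
  have lin: "linear l" "linear l'" using l by (auto simp: complex_functionals_def)
  have "\<i> * hC l l' = (\<Sum>b\<in>Basis. l (F b) * l' b)"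
    using l by (simp add: hC_def complex_functionals_def sum_distrib_left mult.assoc)
  also have "\<dots> = (\<Sum>b\<in>Basis. \<Sum>b'\<in>Basis. of_real (F b \<bullet> b') * l b' * l' b)"
    by (simp add: exp[OF lin(1)] sum_distrib_right)
  also have "\<dots> = (\<Sum>b'\<in>Basis. \<Sum>b\<in>Basis. of_real (F b \<bullet> b') * l b' * l' b)"
    by (rule sum.swap)
  also have "\<dots> = (\<Sum>b'\<in>Basis. \<Sum>b\<in>Basis. - (of_real (F b' \<bullet> b) * l b' * l' b))"
  proof (intro sum.cong refl)
    fix b b' :: 'a
    have "F b \<bullet> b' = - (F b' \<bullet> b)" using F(2)[of b b'] by (simp add: inner_commute)
    then show "of_real (F b \<bullet> b') * l b' * l' b = - (of_real (F b' \<bullet> b) * l b' * l' b)" by simp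
  qed
  also have "\<dots> = - (\<Sum>b'\<in>Basis. l b' * l' (F b'))"
    by (simp add: exp[OF lin(2)] sum_distrib_left sum_negf algebra_simps)
  also have "\<dots> = - (\<i> * hC l l')"
    using l by (simp add: hC_def complex_functionals_def sum_distrib_left mult_ac)
  finally have "\<i> * hC l l' = - (\<i> * hC l l')" .
  then have "2 * (\<i> * hC l l') = 0" by (simp only: mult_2) (metis add.right_inverse)
  then show ?thesis by simp
qed

text \<open>A surjective map \<open>T\<close> onto \<open>\<complex>\<^sup>n\<close> with \<open>T \<circ> F = \<i> T\<close> and the kernel of \<open>F\<close> gives complex linear
  coordinates on the quotient of \<open>V\<close> by the kernel of \<open>F\<close>.\<close>

locale complex_coordinates =
  fixes F :: "'a::euclidean_space \<Rightarrow> 'a" and T :: "'a \<Rightarrow> complex^'n::finite"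
  assumes linear_F: "linear F" and linear_T: "linear T" and surj_T: "surj T"
    and T_F: "T (F v) = \<i> *s T v"
    and F_eq_0: "T v = 0 \<Longrightarrow> F v = 0"
begin

lemma ker_F: "F v = 0 \<longleftrightarrow> T v = 0"
proof
  assume "F v = 0"
  then have "\<i> *s T v = 0" using T_F[of v] by (simp add: linear_0[OF linear_T])
  then show "T v = 0" by (simp add: vec_eq_iff)
qed (rule F_eq_0)

lemma F_cube: "F (F (F v)) = - F v"
proof -
  have "T (F (F v) + v) = 0" by (simp add: linear_add[OF linear_T] T_F)
  then have "F (F (F v) + v) = 0" by (rule F_eq_0)
  then show ?thesis by (simp add: linear_add[OF linear_F] eq_neg_iff_add_eq_0)
qed

lemma subspace_ker_F: "subspace {v. F v = 0}"
  by (rule linear_subspace_kernel[OF linear_F])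

lemma dim_ker_F: "dim {v. F v = 0} + 2 * CARD('n) = DIM('a)"
  using dim_kernel_surj[OF linear_T surj_T] by (simp add: ker_F mult.commute)

lemma component_in_complex_functionals: "(\<lambda>v. T v $ i) \<in> complex_functionals F"
  unfolding complex_functionals_def
  using T_F by (auto intro!: linearI simp: linear_add[OF linear_T] linear_scale[OF linear_T])

lemma complex_functional_eq_0:
  assumes "l \<in> complex_functionals F" "F v = 0"
  shows "l v = 0"
proof -
  have "linear l" "l (F v) = \<i> * l v" using assms(1) by (auto simp: complex_functionals_def)
  then show ?thesis using assms(2) linear_0[of l] by simp
qed

lemma complex_functionals_separate: "F v = 0 \<longleftrightarrow> (\<forall>l\<in>complex_functionals F. l v = 0)"
  using complex_functional_eq_0 component_in_complex_functionals
  by (auto simp: ker_F vec_eq_iff)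

text \<open>A complex-linear functional kills the kernel of \<open>F\<close>, so it factors through \<open>T\<close>.\<close>

lemma complex_functional_expansion:
  assumes l: "l \<in> complex_functionals F" and e: "\<And>i. T (e i) = axis i 1"
  shows "l v = (\<Sum>i\<in>UNIV. l (e i) * T v $ i)"
proof -
  have lin: "linear l" and lF: "l (F u) = \<i> * l u" for u
    using l by (auto simp: complex_functionals_def)
  define w where "w = (\<Sum>i\<in>UNIV. Re (T v $ i) *\<^sub>R e i + Im (T v $ i) *\<^sub>R F (e i))"
  have "T w = (\<Sum>i\<in>UNIV. T v $ i *s axis i 1)"
    unfolding w_def linear_sum[OF linear_T] linear_add[OF linear_T] linear_scale[OF linear_T] T_F e
    by (intro sum.cong refl) (simp add: vec_eq_iff complex_eq_iff)
  then have "T (v - w) = 0" by (simp add: linear_diff[OF linear_T] basis_expansion)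
  from complex_functional_eq_0[OF l F_eq_0[OF this]] have "l v = l w"
    by (simp add: linear_diff[OF lin])
  also have "l w = (\<Sum>i\<in>UNIV. l (e i) * T v $ i)"
    unfolding w_def linear_sum[OF lin] linear_add[OF lin] linear_scale[OF lin] lF
    by (intro sum.cong refl) (simp add: complex_eq_iff)
  finally show ?thesis .
qed

lemma dim_complex_functionals: "cdual_dim (complex_functionals F) = CARD('n)"
proof -
  define c where "c i v = T v $ i" for i v
  define e where "e i = inv T (axis i 1)" for i
  have e: "T (e i) = axis i 1" for i by (simp add: e_def surj_f_inv_f[OF surj_T])
  have ce: "c i (e j) = (if i = j then 1 else 0)" for i j
    by (simp add: c_def e axis_def)
  have inj: "inj c" by (metis ce injI zero_neq_one)
  have sum_apply: "(\<Sum>x\<in>X. f x) v = (\<Sum>x\<in>X. f x v)" for X :: "'i set" and f :: "'i \<Rightarrow> 'a \<Rightarrow> complex" and v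
    by (induction X rule: infinite_finite_induct) auto
  have indep: "cdual.independent (range c)"
    unfolding cdual.dependent_finite[OF finite_imageI[OF finite_class.finite_UNIV]]
  proof (rule notI, elim exE conjE bexE rangeE)
    fix u l i assume s: "(\<Sum>l\<in>range c. cscale (u l) l) = 0" and "u l \<noteq> 0" "l = c i"
    then have ne: "u (c i) \<noteq> 0" by simp
    have "(\<Sum>j\<in>UNIV. u (c j) * c j (e i)) = 0"
      using fun_cong[OF s, of "e i"] by (simp add: sum_apply sum.reindex[OF inj] cscale_def)
    then show False using ne by (simp add: ce if_distrib cong: if_cong)
  qed
  have "l \<in> cdual.span (range c)" if "l \<in> complex_functionals F" for l
  proof -
    have "l = (\<Sum>i\<in>UNIV. cscale (l (e i)) (c i))"
    proof
      fix v show "l v = (\<Sum>i\<in>UNIV. cscale (l (e i)) (c i)) v"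
        unfolding sum_apply cscale_def c_def by (rule complex_functional_expansion[OF that e])
    qed
    also have "\<dots> \<in> cdual.span (range c)"
      by (intro cdual.span_sum cdual.span_scale cdual.span_base) auto
    finally show ?thesis .
  qed
  moreover have "range c \<subseteq> complex_functionals F"
    using component_in_complex_functionals by (auto simp: c_def[abs_def])
  ultimately have "cdual.dim (complex_functionals F) = card (range c)"
    using indep by (intro cdual.dim_unique) auto
  then show ?thesis by (simp add: card_image[OF inj])
qed

lemma cdual_subspace_complex_functionals: "cdual_subspace (complex_functionals F)"
  by (rule cdual.subspaceI)
    (auto simp: complex_functionals_def cscale_def linear_iff algebra_simps)

lemma complex_functionals_in_orth_grassmannian:
  assumes "\<And>v w. F v \<bullet> w = - (v \<bullet> F w)"
  shows "complex_functionals F \<in> orth_grassmannian CARD('n)"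
  unfolding orth_grassmannian_def
  using hC_complex_functionals[OF linear_F assms] dim_complex_functionals
    cdual_subspace_complex_functionals
  by (auto simp: complex_functionals_def)

lemma grass_J_eq: "{w. \<exists>u\<in>quot_map {v. F v = 0} v. F (w - F u) = 0} = quot_map {v. F v = 0} (F v)"
proof (intro set_eqI iffI)
  fix w assume "w \<in> {w. \<exists>u\<in>quot_map {v. F v = 0} v. F (w - F u) = 0}"
  then obtain u where "F (u - v) = 0" "F (w - F u) = 0" by (auto simp: mem_quot_map)
  then have "F u = F v" "F w = F (F u)" by (simp_all add: linear_diff[OF linear_F])
  then show "w \<in> quot_map {v. F v = 0} (F v)" by (simp add: mem_quot_map linear_diff[OF linear_F])
next
  fix w assume "w \<in> quot_map {v. F v = 0} (F v)"
  then have "F (w - F v) = 0" "v \<in> quot_map {v. F v = 0} v"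
    by (simp_all add: mem_quot_map linear_0[OF linear_F])
  then show "w \<in> {w. \<exists>u\<in>quot_map {v. F v = 0} v. F (w - F u) = 0}" by blast
qed

lemma grass_point_eq: "grass_point F = complex_functionals F"
  unfolding grass_point_def
  by (rule quot_dual_eq_complex_functionals[where j = F, OF subspace_ker_F grass_J_eq])
    (use complex_functional_eq_0 in auto)

lemma univ_kernel_complex_functionals: "univ_kernel (complex_functionals F) = {v. F v = 0}"
  unfolding univ_kernel_def by (simp add: complex_functionals_separate)

lemma univ_J_complex_functionals:
  "univ_J (complex_functionals F) (quot_map {v. F v = 0} v) = quot_map {v. F v = 0} (F v)"
proof -
  have "(\<forall>l\<in>complex_functionals F. l w = \<i> * l u) \<longleftrightarrow> F (w - F u) = 0" for w u
    unfolding complex_functionals_separate[of "w - F u"]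
    by (intro ball_cong refl) (auto simp: complex_functionals_def linear_diff)
  then show ?thesis unfolding univ_J_def by (simp flip: grass_J_eq)
qed

lemma isotropic_quotient_complex_functionals:
  assumes "\<And>v w. F v \<bullet> w = - (v \<bullet> F w)"
  shows "isotropic_quotient CARD('n) (univ_kernel (complex_functionals F))
    (univ_J (complex_functionals F))"
proof -
  let ?K = "{v. F v = 0}" and ?J = "univ_J (complex_functionals F)"
  have "quot_map ?K (F (F v)) = quot_map ?K (- v)" for v
    using F_cube[of v] by (simp add: quot_map_eq_iff[OF subspace_ker_F] linear_add[OF linear_F])
  then have "complex_structure_on_quot ?K ?J"
    unfolding complex_structure_on_quot_def
    using linear_F by (auto simp: univ_J_complex_functionals)
  moreover have "quot_dual ?K ?J = complex_functionals F"
    by (rule quot_dual_eq_complex_functionals[where j = F, OF subspace_ker_F univ_J_complex_functionals])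
      (use complex_functional_eq_0 in auto)
  ultimately show ?thesis
    unfolding isotropic_quotient_def univ_kernel_complex_functionals
    using subspace_ker_F dim_ker_F complex_functionals_in_orth_grassmannian[OF assms] by simp
qed

text \<open>If \<open>F\<close> is skew, taking adjoints in \<open>T \<circ> F = \<i> T\<close> shows that the adjoint of \<open>T\<close> is complex
  linear, hence so is \<open>T\<close> composed with its adjoint.\<close>

lemma comp_adjoint_complex_linear:
  assumes "\<And>v w. F v \<bullet> w = - (v \<bullet> F w)"
  shows "T (adjoint T (a *s w)) = a *s T (adjoint T w)"
proof -
  have lin: "linear (\<lambda>w. T (adjoint T w))"
    using linear_compose[OF adjoint_linear[OF linear_T] linear_T] by (simp add: o_def)
  have "adjoint T (\<i> *s w) = F (adjoint T w)" for w
  proof (rule vector_eq_ldot[THEN iffD1], rule allI)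
    fix v
    have "v \<bullet> adjoint T (\<i> *s w) = T v \<bullet> (\<i> *s w)" by (rule adjoint_works[OF linear_T])
    also have "\<dots> = - (T (F v) \<bullet> w)" by (simp add: T_F inner_i_smult)
    also have "\<dots> = - (F v \<bullet> adjoint T w)" by (simp add: adjoint_works[OF linear_T])
    also have "\<dots> = v \<bullet> F (adjoint T w)" by (simp add: assms)
    finally show "v \<bullet> adjoint T (\<i> *s w) = v \<bullet> F (adjoint T w)" .
  qed
  then show ?thesis using linear_i_imp_complex_linear[OF lin, of a w] by (simp add: T_F)
qed

end

section \<open>The $f$-structure of a submersion to a complex manifold\<close>

locale smooth_submersion =
  fixes U :: "'a::euclidean_space set"
    and A :: "('b::topological_space, 'n::finite) chart set"
    and \<phi> :: "'a \<Rightarrow> 'b"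
  assumes open_U: "open U" and atlas: "complex_atlas A" and submersion: "submersion A U \<phi>"
begin

definition dphi :: "('b, 'n) chart \<Rightarrow> 'a \<Rightarrow> 'a \<Rightarrow> complex^'n" where
  "dphi C x = frechet_derivative (snd C \<circ> \<phi>) (at x)"

lemma chart_around: obtains C where "C \<in> A" "y \<in> fst C"
  using atlas unfolding complex_atlas_def by blast

lemma chart:
  assumes "C \<in> A"
  shows open_chart_domain: "open (fst C)"
    and homeomorphism_chart: "homeomorphism (fst C) (snd C ` fst C) (snd C) (inv_into (fst C) (snd C))"
  using assms atlas unfolding complex_atlas_def by auto

lemma inj_on_chart: "C \<in> A \<Longrightarrow> inj_on (snd C) (fst C)"
  using homeomorphism_chart by (metis homeomorphism_apply1 inj_on_inverseI)

lemma continuous_phi: "continuous_on U \<phi>"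
  using submersion unfolding submersion_def smooth_map_def by blast

lemma open_chart_preimage: "C \<in> A \<Longrightarrow> open (U \<inter> \<phi> -` fst C)"
  using continuous_open_preimage[OF continuous_phi open_U open_chart_domain] by simp

lemma smooth_chart_phi: "C \<in> A \<Longrightarrow> smooth_on (U \<inter> \<phi> -` fst C) (snd C \<circ> \<phi>)"
  using submersion unfolding submersion_def smooth_map_def by auto

lemma has_derivative_chart_phi:
  assumes "C \<in> A" "x \<in> U" "\<phi> x \<in> fst C"
  shows "((snd C \<circ> \<phi>) has_derivative dphi C x) (at x)"
  unfolding dphi_def by (rule smooth_on_has_derivative[OF smooth_chart_phi]) (use assms in auto)

lemma linear_dphi: "C \<in> A \<Longrightarrow> x \<in> U \<Longrightarrow> \<phi> x \<in> fst C \<Longrightarrow> linear (dphi C x)"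
  using has_derivative_chart_phi has_derivative_linear by blast

lemma surj_dphi: "C \<in> A \<Longrightarrow> x \<in> U \<Longrightarrow> \<phi> x \<in> fst C \<Longrightarrow> surj (dphi C x)"
  using submersion unfolding submersion_def dphi_def by (cases C) (drule conjunct2, drule (1) bspec, drule (1) bspec, simp)

lemma smooth_dphi: "C \<in> A \<Longrightarrow> smooth_on (U \<inter> \<phi> -` fst C) (\<lambda>x. dphi C x v)"
  unfolding dphi_def by (rule smooth_on_frechet_derivative[OF smooth_chart_phi])

text \<open>The transition maps are holomorphic, so the differentials of \<open>\<phi>\<close> in two charts differ by a complex
  linear map. This makes the kernel, and the condition \<open>d\<phi> \<circ> F = \<i> d\<phi>\<close>, independent of the chart.\<close>

lemma dphi_change_chart:
  assumes "C \<in> A" "C' \<in> A" "x \<in> U" "\<phi> x \<in> fst C" "\<phi> x \<in> fst C'"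
  obtains L where "linear L" "\<And>a w. L (a *s w) = a *s L w" "\<And>v. dphi C' x v = L (dphi C x v)"
proof -
  have hol: "cholomorphic_on (transition C C') (snd C ` (fst C \<inter> fst C'))"
    using atlas assms unfolding complex_atlas_def by blast
  have "(snd C \<circ> \<phi>) x \<in> snd C ` (fst C \<inter> fst C')" using assms by auto
  from bspec[OF hol[unfolded cholomorphic_on_def] this]
  obtain L where L: "(transition C C' has_derivative L) (at ((snd C \<circ> \<phi>) x))"
    "\<forall>a w. L (a *s w) = a *s L w"
    by blast
  have "((transition C C' \<circ> (snd C \<circ> \<phi>)) has_derivative L \<circ> dphi C x) (at x)"
    using diff_chain_at[OF has_derivative_chart_phi L(1)] assms by blast
  then have "((snd C' \<circ> \<phi>) has_derivative L \<circ> dphi C x) (at x)"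
  proof (rule has_derivative_transform_within_open[OF _ open_chart_preimage[OF assms(1)]])
    show "x \<in> U \<inter> \<phi> -` fst C" using assms by simp
    show "(transition C C' \<circ> (snd C \<circ> \<phi>)) y = (snd C' \<circ> \<phi>) y" if "y \<in> U \<inter> \<phi> -` fst C" for y
      using that inj_on_chart[OF assms(1)] by (simp add: transition_def)
  qed
  then have "dphi C' x = L \<circ> dphi C x"
    using has_derivative_chart_phi[OF assms(2,3,5)] has_derivative_unique by blast
  then show ?thesis using that[OF has_derivative_linear[OF L(1)]] L(2) by simp
qed

lemma vertical_eq_ker_dphi:
  assumes "C \<in> A" "x \<in> U" "\<phi> x \<in> fst C"
  shows "vertical A \<phi> x = {v. dphi C x v = 0}"
proof -
  have "dphi C' x v = 0" if "dphi C x v = 0" "C' \<in> A" "\<phi> x \<in> fst C'" for C' v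
    using dphi_change_chart[OF assms(1) that(2) assms(2,3) that(3)] that(1) linear_0 by metis
  then have "v \<in> vertical A \<phi> x \<longleftrightarrow> dphi C x v = 0" for v
    using assms unfolding vertical_def dphi_def by force
  then show ?thesis by blast
qed

lemma horizontal_eq:
  assumes "C \<in> A" "x \<in> U" "\<phi> x \<in> fst C"
  shows "horizontal A \<phi> x = {h. \<forall>v. dphi C x v = 0 \<longrightarrow> h \<bullet> v = 0}"
  unfolding horizontal_def vertical_eq_ker_dphi[OF assms] orthogonal_comp_def
  by (auto simp: orthogonal_def inner_commute)

lemma horizontal_part_eq_lift:
  assumes "C \<in> A" "x \<in> U" "\<phi> x \<in> fst C"
  shows "horizontal_part A \<phi> x w = horizontal_lift (dphi C x) (dphi C x w)"
proof -
  note T = linear_dphi[OF assms] surj_dphi[OF assms]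
  show ?thesis
    unfolding horizontal_part_def
  proof (rule the_equality)
    show "horizontal_lift (dphi C x) (dphi C x w) \<in> horizontal A \<phi> x \<and>
        w - horizontal_lift (dphi C x) (dphi C x w) \<in> vertical A \<phi> x"
      using horizontal_lift_orthogonal[OF T] horizontal_lift_right_inverse[OF T]
      by (simp add: horizontal_eq[OF assms] vertical_eq_ker_dphi[OF assms] linear_diff[OF T(1)])
  next
    fix h assume "h \<in> horizontal A \<phi> x \<and> w - h \<in> vertical A \<phi> x"
    then have "\<And>v. dphi C x v = 0 \<Longrightarrow> h \<bullet> v = 0" "dphi C x w = dphi C x h"
      by (simp_all add: horizontal_eq[OF assms] vertical_eq_ker_dphi[OF assms] linear_diff[OF T(1)])
    then show "h = horizontal_lift (dphi C x) (dphi C x w)"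
      using horizontal_lift_left_inverse[OF T] by simp
  qed
qed

text \<open>An endomorphism that kills the vertical and preserves the horizontal space is determined by its
  composition with \<open>d\<phi>\<close>, because \<open>d\<phi>\<close> is injective on the horizontal space.\<close>

lemma induced_F_eq_lift:
  assumes "C \<in> A" "x \<in> U" "\<phi> x \<in> fst C"
  shows "induced_F A \<phi> x = (\<lambda>v. horizontal_lift (dphi C x) (\<i> *s dphi C x v))"
proof -
  note T = linear_dphi[OF assms] surj_dphi[OF assms]
  define G where "G = horizontal_lift (dphi C x)"
  have G: "linear G" "\<And>w. dphi C x (G w) = w" "\<And>w v. dphi C x v = 0 \<Longrightarrow> G w \<bullet> v = 0"
    "\<And>u. (\<And>v. dphi C x v = 0 \<Longrightarrow> u \<bullet> v = 0) \<Longrightarrow> G (dphi C x u) = u"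
    using horizontal_lift[OF T] unfolding G_def by blast+
  have "linear (\<lambda>v. G (\<i> *s dphi C x v))"
    using linear_compose[OF linear_compose[OF T(1) bounded_linear.linear[OF bounded_linear_vec_smult[of \<i>]]] G(1)]
    by (simp add: o_def)
  moreover have "dphi C' x (G (\<i> *s dphi C x v)) = \<i> *s dphi C' x v" if "C' \<in> A" "\<phi> x \<in> fst C'" for C' v
    using dphi_change_chart[OF assms(1) that(1) assms(2,3) that(2)] G(2) by metis
  ultimately show ?thesis
    unfolding induced_F_def G_def[symmetric]
  proof (intro the_equality conjI ballI)
    fix v assume "v \<in> vertical A \<phi> x"
    then show "G (\<i> *s dphi C x v) = 0"
      by (simp add: vertical_eq_ker_dphi[OF assms] linear_0[OF G(1)])
  next
    show "(\<lambda>v. G (\<i> *s dphi C x v)) ` horizontal A \<phi> x \<subseteq> horizontal A \<phi> x"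
      using G(3) by (auto simp: horizontal_eq[OF assms])
  next
    fix F assume F: "linear F \<and> (\<forall>v\<in>vertical A \<phi> x. F v = 0) \<and>
       F ` horizontal A \<phi> x \<subseteq> horizontal A \<phi> x \<and>
       (\<forall>(D, c)\<in>A. \<phi> x \<in> D \<longrightarrow> (\<forall>v. frechet_derivative (c \<circ> \<phi>) (at x) (F v) =
          \<i> *s frechet_derivative (c \<circ> \<phi>) (at x) v))"
    have TF: "dphi C x (F v) = \<i> *s dphi C x v" for v
      using F assms unfolding dphi_def by auto
    show "F = (\<lambda>v. G (\<i> *s dphi C x v))"
    proof
      fix v
      define h where "h = G (dphi C x v)"
      have "h \<in> horizontal A \<phi> x" using G(3) by (simp add: h_def horizontal_eq[OF assms])
      then have "F h \<in> horizontal A \<phi> x" using F by blast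
      then have "G (dphi C x (F h)) = F h" using G(4) by (simp add: horizontal_eq[OF assms])
      moreover have "dphi C x (v - h) = 0" using G(2) by (simp add: h_def linear_diff[OF T(1)])
      then have "F (v - h) = 0" using F by (simp add: vertical_eq_ker_dphi[OF assms])
      then have "F v = F h" using F by (simp add: linear_diff)
      ultimately show "F v = G (\<i> *s dphi C x v)" using TF by metis
    qed
  qed (auto simp: dphi_def split: prod.splits)
qed

lemma complex_coordinates_dphi:
  assumes "C \<in> A" "x \<in> U" "\<phi> x \<in> fst C"
  shows "complex_coordinates (induced_F A \<phi> x) (dphi C x)"
proof (rule complex_coordinates.intro)
  note T = linear_dphi[OF assms] surj_dphi[OF assms]
  show "linear (induced_F A \<phi> x)"
    unfolding induced_F_eq_lift[OF assms]
    using linear_compose[OF linear_compose[OF T(1) bounded_linear.linear[OF bounded_linear_vec_smult[of \<i>]]]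
        linear_horizontal_lift[OF T]]
    by (simp add: o_def)
  fix v
  show "dphi C x (induced_F A \<phi> x v) = \<i> *s dphi C x v"
    unfolding induced_F_eq_lift[OF assms] by (rule horizontal_lift_right_inverse[OF T])
  assume "dphi C x v = 0"
  then show "induced_F A \<phi> x v = 0"
    unfolding induced_F_eq_lift[OF assms] using linear_0[OF linear_horizontal_lift[OF T]] by simp
qed (rule linear_dphi[OF assms] surj_dphi[OF assms])+

text \<open>The orthogonal projection onto the horizontal space: \<open>F\<close> is a complex structure there and zero on
  the vertical space.\<close>

definition P :: "'a \<Rightarrow> 'a \<Rightarrow> 'a" where
  "P x v = - induced_F A \<phi> x (induced_F A \<phi> x v)"

lemma dphi_F:
  assumes "C \<in> A" "x \<in> U" "\<phi> x \<in> fst C"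
  shows "dphi C x (induced_F A \<phi> x v) = \<i> *s dphi C x v"
  by (rule complex_coordinates.T_F[OF complex_coordinates_dphi[OF assms]])

lemma dphi_P:
  assumes "C \<in> A" "x \<in> U" "\<phi> x \<in> fst C"
  shows "dphi C x (P x v) = dphi C x v"
  by (simp add: P_def linear_neg[OF linear_dphi[OF assms]] dphi_F[OF assms])

lemma P_eq_lift:
  assumes "C \<in> A" "x \<in> U" "\<phi> x \<in> fst C"
  shows "P x v = horizontal_lift (dphi C x) (dphi C x v)"
  using horizontal_lift[OF linear_dphi[OF assms] surj_dphi[OF assms]]
  by (simp add: P_def induced_F_eq_lift[OF assms] linear_neg)

lemma linear_F: "x \<in> U \<Longrightarrow> linear (induced_F A \<phi> x)"
  using complex_coordinates_dphi complex_coordinates.linear_F by (metis chart_around)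

lemma linear_P: "x \<in> U \<Longrightarrow> linear (P x)"
  using linear_F[of x] unfolding P_def by (auto simp: linear_iff)

lemma F_cube: "x \<in> U \<Longrightarrow> induced_F A \<phi> x (induced_F A \<phi> x (induced_F A \<phi> x v)) = - induced_F A \<phi> x v"
  using complex_coordinates_dphi complex_coordinates.F_cube by (metis chart_around)

lemma F_P: "x \<in> U \<Longrightarrow> induced_F A \<phi> x (P x v) = induced_F A \<phi> x v"
  by (simp add: P_def linear_neg[OF linear_F] F_cube)

lemma P_F: "x \<in> U \<Longrightarrow> P x (induced_F A \<phi> x v) = induced_F A \<phi> x v"
  by (simp add: P_def F_cube)

lemma P_P: "x \<in> U \<Longrightarrow> P x (P x v) = P x v"
  by (simp add: P_def linear_neg[OF linear_F] F_cube)

lemma vertical_eq_ker_F: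
  assumes "x \<in> U" shows "vertical A \<phi> x = {v. induced_F A \<phi> x v = 0}"
proof -
  obtain C where "C \<in> A" "\<phi> x \<in> fst C" by (rule chart_around)
  with assms show ?thesis
    using complex_coordinates.ker_F[OF complex_coordinates_dphi] by (simp add: vertical_eq_ker_dphi)
qed

lemma vertical_iff_P: "x \<in> U \<Longrightarrow> v \<in> vertical A \<phi> x \<longleftrightarrow> P x v = 0"
  using F_P[of x v] linear_0[OF linear_F[of x]] by (auto simp: vertical_eq_ker_F P_def)

lemma subspace_vertical: "x \<in> U \<Longrightarrow> subspace (vertical A \<phi> x)"
  by (simp add: vertical_eq_ker_F linear_subspace_kernel linear_F)

lemma vertical_diff_P: "x \<in> U \<Longrightarrow> v - P x v \<in> vertical A \<phi> x"
  by (simp add: vertical_iff_P linear_diff[OF linear_P] P_P)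

lemma horizontal_part_eq_P:
  assumes "x \<in> U" shows "horizontal_part A \<phi> x w = P x w"
proof -
  obtain C where "C \<in> A" "\<phi> x \<in> fst C" by (rule chart_around)
  with assms show ?thesis by (simp add: P_eq_lift horizontal_part_eq_lift)
qed

lemma P_horizontal:
  assumes "x \<in> U" shows "P x w \<in> horizontal A \<phi> x"
proof -
  obtain C where C: "C \<in> A" "\<phi> x \<in> fst C" by (rule chart_around)
  note T = linear_dphi[OF C(1) assms C(2)] surj_dphi[OF C(1) assms C(2)]
  show ?thesis
    using horizontal_lift_orthogonal[OF T] C assms by (simp add: P_eq_lift horizontal_eq)
qed

end

locale phwc_submersion = smooth_submersion U A \<phi>
  for U :: "'a::euclidean_space set"
    and A :: "('b::topological_space, 'n::finite) chart set"
    and \<phi> :: "'a \<Rightarrow> 'b" +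
  assumes PHWC: "PHWC A U \<phi>"
begin

lemma F_skew: "x \<in> U \<Longrightarrow> induced_F A \<phi> x v \<bullet> w = - (v \<bullet> induced_F A \<phi> x w)"
  using PHWC unfolding PHWC_def by blast

lemma P_symmetric: "x \<in> U \<Longrightarrow> P x v \<bullet> w = v \<bullet> P x w"
  by (simp add: P_def F_skew)

text \<open>By complex linearity of \<open>T T\<^sup>*\<close>, the vector \<open>F v = T\<^sup>* (T T\<^sup>*)\<^sup>-\<^sup>1 (\<i> T v)\<close> is given by Cramer's rule
  for a complex matrix whose entries are smooth functions of the point.\<close>

lemma smooth_F: "smooth_on U (\<lambda>x. induced_F A \<phi> x v)"
proof (rule smooth_on_local)
  fix x0 assume "x0 \<in> U"
  obtain C where C: "C \<in> A" "\<phi> x0 \<in> fst C" by (rule chart_around)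
  define S where "S = U \<inter> \<phi> -` fst C"
  have S: "open S" "x0 \<in> S" "S \<subseteq> U"
    using open_chart_preimage[OF C(1)] C \<open>x0 \<in> U\<close> by (auto simp: S_def)
  define T where "T = dphi C"
  have smooth_T: "smooth_on S (\<lambda>x. T x b)" for b
    unfolding T_def S_def by (rule smooth_dphi[OF C(1)])
  have T: "linear (T x)" "surj (T x)" "complex_coordinates (induced_F A \<phi> x) (T x)" if "x \<in> S" for x
    using linear_dphi[OF C(1)] surj_dphi[OF C(1)] complex_coordinates_dphi[OF C(1)] that
    by (auto simp: T_def S_def)
  define N where "N x = matrix (\<lambda>w. T x (adjoint (T x) w))" for x
  have N: "N x *v w = T x (adjoint (T x) w)" if "x \<in> S" for x w
    unfolding N_def
  proof (rule matrix_works, unfold_locales)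
    show "T x (adjoint (T x) (u + w)) = T x (adjoint (T x) u) + T x (adjoint (T x) w)" for u w
      using T(1)[OF that] adjoint_linear[OF T(1)[OF that]] by (simp add: linear_add)
    show "T x (adjoint (T x) (a *s w)) = a *s T x (adjoint (T x) w)" for a w
      using that S F_skew by (intro complex_coordinates.comp_adjoint_complex_linear[OF T(3)]) auto
  qed
  have det: "det (N x) \<noteq> 0" if "x \<in> S" for x
  proof -
    have "inj ((*v) (N x))"
      using bij_is_inj[OF bij_comp_adjoint[OF T(1,2)[OF that]]] by (simp add: N[OF that] o_def inj_def)
    then have "invertible (N x)"
      by (simp add: invertible_left_inverse matrix_left_invertible_injective)
    then show ?thesis by (simp add: invertible_det_nz)
  qed
  have smooth_N: "smooth_on S (\<lambda>x. N x $ i $ j)" for i j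
  proof (rule smooth_on_cong[THEN iffD1, OF S(1)])
    show "smooth_on S (\<lambda>x. \<Sum>b\<in>Basis. (T x b \<bullet> axis j 1) *\<^sub>R (T x b $ i))"
      by (rule smooth_on_sum[OF S(1)], rule smooth_on_bilinear[OF S(1) bounded_bilinear_scaleR],
          rule smooth_on_bounded_linear[OF S(1) bounded_linear_inner_left smooth_T],
          rule smooth_on_bounded_linear[OF S(1) bounded_linear_vec_nth smooth_T])
    show "(\<Sum>b\<in>Basis. (T x b \<bullet> axis j 1) *\<^sub>R (T x b $ i)) = N x $ i $ j" if "x \<in> S" for x
      using T(1)[OF that] by (simp add: N_def matrix_def adjoint_eq_sum linear_sum linear_scale)
  qed
  define z where "z x k = det (\<chi> i j. if j = k then (\<i> *s T x v) $ i else N x $ i $ j) * inverse (det (N x))"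
    for x k
  have smooth_z: "smooth_on S (\<lambda>x. z x k)" for k
    unfolding z_def
  proof (rule smooth_on_bilinear[OF S(1) bounded_bilinear_mult])
    show "smooth_on S (\<lambda>x. inverse (det (N x)))"
      using det smooth_N by (intro smooth_on_inverse smooth_on_det S(1)) auto
    have "smooth_on S (\<lambda>x. (\<chi> i j. if j = k then (\<i> *s T x v) $ i else N x $ i $ j) $ i $ j)" for i j
    proof (cases "j = k")
      case True
      then show ?thesis
        using smooth_on_bounded_linear[OF S(1) bounded_linear_mult_right[of \<i>]
            smooth_on_bounded_linear[OF S(1) bounded_linear_vec_nth[of i] smooth_T]] by simp
    qed (simp add: smooth_N)
    then show "smooth_on S (\<lambda>x. det (\<chi> i j. if j = k then (\<i> *s T x v) $ i else N x $ i $ j))"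
      by (rule smooth_on_det[OF S(1)])
  qed
  have "smooth_on S (\<lambda>x. \<Sum>b\<in>Basis. (\<Sum>k\<in>UNIV. T x b $ k \<bullet> z x k) *\<^sub>R b)"
    by (intro smooth_on_sum[OF S(1)],
        rule smooth_on_bounded_linear[OF S(1) bounded_linear_scaleR_left],
        intro smooth_on_sum[OF S(1)], rule smooth_on_bilinear[OF S(1) bounded_bilinear_inner],
        rule smooth_on_bounded_linear[OF S(1) bounded_linear_vec_nth smooth_T], rule smooth_z)
  moreover have "(\<Sum>b\<in>Basis. (\<Sum>k\<in>UNIV. T x b $ k \<bullet> z x k) *\<^sub>R b) = induced_F A \<phi> x v" if "x \<in> S" for x
  proof -
    have "N x *v (\<chi> k. z x k) = \<i> *s T x v"
      using cramer[OF det[OF that], of "\<chi> k. z x k" "\<i> *s T x v"] by (simp add: z_def divide_inverse)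
    then have "T x (adjoint (T x) (\<chi> k. z x k)) = \<i> *s T x v" unfolding N[OF that] .
    then have "horizontal_lift (T x) (\<i> *s T x v) = adjoint (T x) (\<chi> k. z x k)"
      by (rule horizontal_lift_eq_adjoint[OF T(1,2)[OF that]])
    moreover have "induced_F A \<phi> x v = horizontal_lift (T x) (\<i> *s T x v)"
      unfolding T_def using that by (subst induced_F_eq_lift[OF C(1)]) (auto simp: S_def)
    ultimately show ?thesis by (simp add: adjoint_eq_sum[OF T(1)[OF that]] inner_vec_def)
  qed
  ultimately have "smooth_on S (\<lambda>x. induced_F A \<phi> x v)"
    by (rule smooth_on_cong[THEN iffD1, OF S(1), rotated])
  moreover have "U \<inter> S = S" using S by blast
  ultimately show "\<exists>S. open S \<and> x0 \<in> S \<and> smooth_on (U \<inter> S) (\<lambda>x. induced_F A \<phi> x v)"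
    using S by auto
qed

end

section \<open>Derivatives of fields of linear maps\<close>

locale operator_field =
  fixes S :: "'a::euclidean_space set" and A :: "'a \<Rightarrow> 'd::euclidean_space \<Rightarrow> 'c::euclidean_space"
  assumes open_S: "open S" and linear: "x \<in> S \<Longrightarrow> linear (A x)" and smooth: "smooth_on S (\<lambda>x. A x v)"
begin

definition D :: "'a \<Rightarrow> 'a \<Rightarrow> 'd \<Rightarrow> 'c" where
  "D x u v = frechet_derivative (\<lambda>y. A y v) (at x) u"

lemma has_derivative: "x \<in> S \<Longrightarrow> ((\<lambda>y. A y v) has_derivative (\<lambda>u. D x u v)) (at x)"
  unfolding D_def by (rule smooth_on_has_derivative[OF smooth])

lemma expansion:
  assumes "x \<in> S"
  shows "(\<Sum>b\<in>Basis. (v \<bullet> b) *\<^sub>R A x b) = A x v"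
proof -
  have "A x (\<Sum>b\<in>Basis. (v \<bullet> b) *\<^sub>R b) = (\<Sum>b\<in>Basis. (v \<bullet> b) *\<^sub>R A x b)"
    by (simp add: linear_sum[OF linear[OF assms]] linear_scale[OF linear[OF assms]])
  then show ?thesis by (simp add: euclidean_representation)
qed

lemma product_rule:
  assumes "x \<in> S" "(Y has_derivative Y') (at x)"
  shows "((\<lambda>y. A y (Y y)) has_derivative (\<lambda>u. D x u (Y x) + A x (Y' u))) (at x)"
proof -
  have *: "((\<lambda>y. A y (Z y)) has_derivative
      (\<lambda>u. \<Sum>b\<in>Basis. (Z x \<bullet> b) *\<^sub>R D x u b + (Z' u \<bullet> b) *\<^sub>R A x b)) (at x)"
    if "(Z has_derivative Z') (at x)" for Z Z'
  proof (rule has_derivative_transform_within_open[OF _ open_S assms(1)])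
    show "((\<lambda>y. \<Sum>b\<in>Basis. (Z y \<bullet> b) *\<^sub>R A y b) has_derivative
      (\<lambda>u. \<Sum>b\<in>Basis. (Z x \<bullet> b) *\<^sub>R D x u b + (Z' u \<bullet> b) *\<^sub>R A x b)) (at x)"
      by (intro has_derivative_sum has_derivative_scaleR has_derivative_inner_left that
          has_derivative assms(1))
  qed (rule expansion)
  have "((\<lambda>y. A y (Y x)) has_derivative
      (\<lambda>u. \<Sum>b\<in>Basis. (Y x \<bullet> b) *\<^sub>R D x u b + (0 \<bullet> b) *\<^sub>R A x b)) (at x)"
    by (rule *[OF has_derivative_const])
  from fun_cong[OF has_derivative_unique[OF this has_derivative[OF assms(1)]]]
  have "(\<Sum>b\<in>Basis. (Y x \<bullet> b) *\<^sub>R D x u b) = D x u (Y x)" for u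
    by simp
  then have "(\<lambda>u. \<Sum>b\<in>Basis. (Y x \<bullet> b) *\<^sub>R D x u b + (Y' u \<bullet> b) *\<^sub>R A x b)
      = (\<lambda>u. D x u (Y x) + A x (Y' u))"
    by (simp only: sum.distrib expansion[OF assms(1)])
  with *[OF assms(2)] show ?thesis by (simp only:)
qed

lemma smooth_apply:
  assumes "smooth_on S Y"
  shows "smooth_on S (\<lambda>x. A x (Y x))"
proof (rule smooth_on_cong[THEN iffD1, OF open_S])
  show "smooth_on S (\<lambda>x. \<Sum>b\<in>Basis. (Y x \<bullet> b) *\<^sub>R A x b)"
    by (rule smooth_on_sum[OF open_S], rule smooth_on_bilinear[OF open_S bounded_bilinear_scaleR],
        rule smooth_on_bounded_linear[OF open_S bounded_linear_inner_left assms], rule smooth)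
qed (rule expansion)

lemma linear_D: "x \<in> S \<Longrightarrow> linear (\<lambda>u. D x u v)"
  by (rule has_derivative_linear[OF has_derivative])

end

section \<open>Parallelism of the $f$-structure along the fibres\<close>

locale sphh_submersion = smooth_submersion U A \<phi>
  for U :: "'a::euclidean_space set"
    and A :: "('b::topological_space, 'n::finite) chart set"
    and \<phi> :: "'a \<Rightarrow> 'b" +
  assumes sPHH: "sPHH A U \<phi>" and geodesic: "totally_geodesic_fibres A U \<phi>"

sublocale sphh_submersion \<subseteq> phwc_submersion
  using sPHH by unfold_locales (simp add: sPHH_def)

sublocale phwc_submersion \<subseteq> F: operator_field U "induced_F A \<phi>"
  by (rule operator_field.intro[OF open_U linear_F smooth_F])

lemma (in phwc_submersion) smooth_P: "smooth_on U (\<lambda>x. P x v)"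
  unfolding P_def
  by (rule smooth_on_bounded_linear[OF open_U bounded_linear_minus[OF bounded_linear_ident]],
      rule F.smooth_apply[OF smooth_F])

sublocale phwc_submersion \<subseteq> P: operator_field U P
  by (rule operator_field.intro[OF open_U linear_P smooth_P])

context sphh_submersion
begin

text \<open>The derivative of \<open>P \<circ> P = P\<close>. In particular \<open>P (D\<^sub>u P) v = 0\<close> for horizontal \<open>v\<close>.\<close>

lemma P_DP:
  assumes "x \<in> U"
  shows "P x (P.D x u v) = P.D x u v - P.D x u (P x v)"
proof -
  have "((\<lambda>y. P y v) has_derivative (\<lambda>u. P.D x u (P x v) + P x (P.D x u v))) (at x)"
    by (rule has_derivative_transform_within_open[OF
          P.product_rule[OF assms P.has_derivative[OF assms]] open_U assms]) (simp add: P_P)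
  note eq = fun_cong[OF has_derivative_unique[OF P.has_derivative[OF assms] this], of u]
  have "c = a - b" if "a = b + c" for a b c :: 'a using that by simp
  from this[OF eq] show ?thesis .
qed

lemma DP_symmetric:
  assumes "x \<in> U"
  shows "P.D x u v \<bullet> w = v \<bullet> P.D x u w"
proof -
  have "((\<lambda>y. P y v \<bullet> w) has_derivative (\<lambda>u. P.D x u v \<bullet> w)) (at x)"
    by (rule has_derivative_inner_left[OF P.has_derivative[OF assms]])
  moreover have "((\<lambda>y. P y v \<bullet> w) has_derivative (\<lambda>u. v \<bullet> P.D x u w)) (at x)"
    by (rule has_derivative_transform_within_open[OF
          has_derivative_inner_right[OF P.has_derivative[OF assms]] open_U assms])
      (simp add: P_symmetric)
  ultimately show ?thesis using has_derivative_unique by (metis (mono_tags, lifting))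
qed

text \<open>The vanishing of the second fundamental form, applied to the vertical fields \<open>u - P u\<close> and \<open>v - P v\<close>
  of two constant vectors.\<close>

lemma P_DP_vertical:
  assumes "x \<in> U" "u \<in> vertical A \<phi> x"
  shows "P x (P.D x u v) = 0"
proof -
  let ?X = "\<lambda>w y. w + - P y w"
  have smooth: "smooth_on U (?X w)" for w
    by (intro smooth_on_add[OF open_U smooth_on_const]
        smooth_on_bounded_linear[OF open_U bounded_linear_minus[OF bounded_linear_ident] smooth_P])
  have vert: "?X w y \<in> vertical A \<phi> y" if "y \<in> U" for w y
    using vertical_diff_P[OF that] by simp
  have "nabla (?X u) (?X v) x \<in> vertical A \<phi> x"
    using geodesic smooth vert assms(1) unfolding totally_geodesic_fibres_def by blast
  moreover have "(?X v has_derivative (\<lambda>w. 0 + - P.D x w v)) (at x)"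
    by (intro has_derivative_add has_derivative_const has_derivative_minus P.has_derivative assms(1))
  from frechet_derivative_at[OF this] have "frechet_derivative (?X v) (at x) u = - P.D x u v"
    by (metis add_0)
  moreover have "?X u x = u" using assms by (simp add: vertical_iff_P)
  ultimately show ?thesis
    using assms(1) by (simp add: nabla_def vertical_iff_P linear_neg[OF linear_P])
qed

text \<open>As \<open>D\<^sub>u P\<close> is symmetric and exchanges the vertical and the horizontal space, its vanishing
  follows from that of its horizontal component.\<close>

lemma DP_vertical:
  assumes "x \<in> U" "u \<in> vertical A \<phi> x"
  shows "P.D x u v = 0"
proof -
  have "P.D x u v \<bullet> w = 0" for w
  proof -
    have "P.D x u v = P.D x u (P x v)" using P_DP[of x u v] P_DP_vertical[of x u v] assms by simp
    then have "P.D x u v \<bullet> w = P x v \<bullet> P.D x u w" using DP_symmetric[OF assms(1)] by simp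
    also have "\<dots> = v \<bullet> P x (P.D x u w)" by (rule P_symmetric[OF assms(1)])
    finally show ?thesis using P_DP_vertical[OF assms] by simp
  qed
  from this[of "P.D x u v"] show ?thesis by simp
qed

text \<open>The strong homothety condition for the constant field \<open>u\<close> and the horizontal field \<open>P v\<close>, as
  \<open>F (P v) = F v\<close>. It determines the horizontal part of \<open>D F\<close> by \<open>D P\<close>.\<close>

lemma P_DF:
  assumes "x \<in> U"
  shows "P x (F.D x u v) = induced_F A \<phi> x (P.D x u v)"
proof -
  have "\<forall>y\<in>U. P y v \<in> horizontal A \<phi> y" using P_horizontal by blast
  then have "horizontal_part A \<phi> x (nabla (\<lambda>_. u) (\<lambda>y. induced_F A \<phi> y (P y v)) x)
      = induced_F A \<phi> x (nabla (\<lambda>_. u) (\<lambda>y. P y v) x)"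
    using sPHH smooth_on_const smooth_P assms unfolding sPHH_def by blast
  moreover have "((\<lambda>y. induced_F A \<phi> y (P y v)) has_derivative (\<lambda>u. F.D x u v)) (at x)"
    by (rule has_derivative_transform_within_open[OF F.has_derivative[OF assms] open_U assms])
      (simp add: F_P)
  from frechet_derivative_at[OF this]
  have "frechet_derivative (\<lambda>y. induced_F A \<phi> y (P y v)) (at x) u = F.D x u v" by metis
  ultimately show ?thesis
    using assms by (simp add: nabla_def horizontal_part_eq_P P.D_def)
qed

text \<open>Differentiating \<open>F = P F\<close> leaves only terms with \<open>D\<^sub>u P\<close>.\<close>

lemma DF_vertical:
  assumes "x \<in> U" "u \<in> vertical A \<phi> x"
  shows "F.D x u v = 0"
proof -
  have "((\<lambda>y. induced_F A \<phi> y v) has_derivative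
      (\<lambda>u. P.D x u (induced_F A \<phi> x v) + P x (F.D x u v))) (at x)"
    by (rule has_derivative_transform_within_open[OF
          P.product_rule[OF assms(1) F.has_derivative[OF assms(1)]] open_U assms(1)]) (simp add: P_F)
  note eq = fun_cong[OF has_derivative_unique[OF F.has_derivative[OF assms(1)] this], of u]
  show ?thesis
    unfolding eq[unfolded P_DF[OF assms(1)]] using assms by (simp add: DP_vertical linear_0[OF linear_F])
qed

end

section \<open>Complex linearity of the Hessian\<close>

lemma (in smooth_submersion) operator_field_dphi:
  assumes "C \<in> A"
  shows "operator_field (U \<inter> \<phi> -` fst C) (dphi C)"
proof (rule operator_field.intro[OF open_chart_preimage[OF assms]])
  show "smooth_on (U \<inter> \<phi> -` fst C) (\<lambda>x. dphi C x v)" for v by (rule smooth_dphi[OF assms])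
  show "linear (dphi C x)" if "x \<in> U \<inter> \<phi> -` fst C" for x
    using that linear_dphi[OF assms] by simp
qed

context sphh_submersion
begin

text \<open>Differentiating \<open>T \<circ> F = \<i> T\<close> expresses the failure of the Hessian to be complex linear in its
  second argument by \<open>T (D\<^sub>u F)\<close>, which equals \<open>\<i> T (D\<^sub>u P)\<close> and vanishes on horizontal vectors.\<close>

lemma hessian_complex_linear_right:
  assumes C: "C \<in> A" "x \<in> U" "\<phi> x \<in> fst C" and v: "P x v = v"
  shows "operator_field.D (dphi C) x u (induced_F A \<phi> x v) = \<i> *s operator_field.D (dphi C) x u v"
proof -
  interpret T: operator_field "U \<inter> \<phi> -` fst C" "dphi C" by (rule operator_field_dphi[OF C(1)])
  have x: "x \<in> U \<inter> \<phi> -` fst C" using C by simp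
  have "((\<lambda>y. \<i> *s dphi C y v) has_derivative
      (\<lambda>u. T.D x u (induced_F A \<phi> x v) + dphi C x (F.D x u v))) (at x)"
    by (rule has_derivative_transform_within_open[OF
          T.product_rule[OF x F.has_derivative[OF C(2)]] T.open_S x]) (use C in \<open>simp add: dphi_F\<close>)
  moreover have "((\<lambda>y. \<i> *s dphi C y v) has_derivative (\<lambda>u. \<i> *s T.D x u v)) (at x)"
    by (rule bounded_linear.has_derivative[OF bounded_linear_vec_smult T.has_derivative[OF x]])
  ultimately have "T.D x u (induced_F A \<phi> x v) + dphi C x (F.D x u v) = \<i> *s T.D x u v"
    using has_derivative_unique by (metis (mono_tags, lifting))
  moreover have "dphi C x (F.D x u v) = \<i> *s dphi C x (P x (P.D x u v))"
    using dphi_P[OF C] dphi_F[OF C] P_DF[OF C(2)] by metis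
  then have "dphi C x (F.D x u v) = 0"
    using P_DP[OF C(2), of u v] v by (simp add: linear_0[OF linear_dphi[OF C]])
  ultimately show ?thesis by simp
qed

text \<open>The Hessian is symmetric. So \<open>d\<phi>\<close>, seen as a function of the point, satisfies the Cauchy--Riemann
  equations in horizontal directions, although it need not be constant along the fibres.\<close>

lemma hessian_complex_linear_left:
  assumes C: "C \<in> A" "x \<in> U" "\<phi> x \<in> fst C" and u: "P x u = u"
  shows "operator_field.D (dphi C) x (induced_F A \<phi> x u) v = \<i> *s operator_field.D (dphi C) x u v"
proof -
  interpret T: operator_field "U \<inter> \<phi> -` fst C" "dphi C" by (rule operator_field_dphi[OF C(1)])
  have sym: "T.D x u v = T.D x v u" for u v
    unfolding T.D_def dphi_def
    using second_derivative_symmetric[OF T.open_S _ smooth_chart_phi[OF C(1)]] C by simp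
  show ?thesis
    using hessian_complex_linear_right[OF C u, of v] by (simp only: sym[of v])
qed

end

section \<open>The fibres are open subsets of affine subspaces\<close>

text \<open>Gronwall's inequality for a solution with initial value zero: \<open>exp (- 2 B t) \<bar>p t\<bar>\<^sup>2\<close> does not
  increase.\<close>

lemma vanishing_by_gronwall:
  fixes p :: "real \<Rightarrow> 'a::real_inner"
  assumes p: "\<And>s. 0 \<le> s \<Longrightarrow> s \<le> t \<Longrightarrow> (p has_vector_derivative p' s) (at s)"
    and le: "\<And>s. 0 \<le> s \<Longrightarrow> s \<le> t \<Longrightarrow> norm (p' s) \<le> B * norm (p s)"
    and "p 0 = 0" "0 \<le> t"
  shows "p t = 0"
proof -
  define r where "r s = exp (- 2 * B * s) * (p s \<bullet> p s)" for s
  define r' where "r' s = exp (- 2 * B * s) * (2 * (p s \<bullet> p' s) - 2 * B * (p s \<bullet> p s))" for s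
  have dr: "(r has_real_derivative r' s) (at s)" if s: "0 \<le> s" "s \<le> t" for s
  proof -
    have "((\<lambda>s. p s \<bullet> p s) has_derivative (\<lambda>h. p s \<bullet> (h *\<^sub>R p' s) + (h *\<^sub>R p' s) \<bullet> p s)) (at s)"
      using p[OF s] unfolding has_vector_derivative_def by (rule has_derivative_inner) (rule p[OF s, unfolded has_vector_derivative_def])
    moreover have "(\<lambda>h. p s \<bullet> (h *\<^sub>R p' s) + (h *\<^sub>R p' s) \<bullet> p s) = (*) (2 * (p s \<bullet> p' s))"
      by (auto simp: inner_commute algebra_simps)
    ultimately have "((\<lambda>s. p s \<bullet> p s) has_real_derivative 2 * (p s \<bullet> p' s)) (at s)"
      by (simp add: has_field_derivative_def)
    note square = this
    have "((\<lambda>s. exp (- 2 * B * s)) has_real_derivative exp (- 2 * B * s) * (- 2 * B)) (at s)"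
      by (auto intro!: derivative_eq_intros)
    from DERIV_mult[OF this square] show ?thesis
      unfolding r_def[abs_def] by (rule DERIV_cong) (simp add: r'_def algebra_simps)
  qed
  have nonpos: "r' s \<le> 0" if s: "0 \<le> s" "s \<le> t" for s
  proof -
    have "p s \<bullet> p' s \<le> norm (p s) * norm (p' s)" by (rule norm_cauchy_schwarz)
    also have "\<dots> \<le> norm (p s) * (B * norm (p s))" using le[OF s] by (rule mult_left_mono) simp
    also have "\<dots> = B * (p s \<bullet> p s)" by (simp add: dot_square_norm power2_eq_square)
    finally show ?thesis unfolding r'_def by (simp add: mult_nonneg_nonpos)
  qed
  have "r t \<le> r 0"
  proof (rule DERIV_nonpos_imp_nonincreasing[OF \<open>0 \<le> t\<close>])
    fix s assume "0 \<le> s" "s \<le> t"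
    then show "\<exists>d. (r has_real_derivative d) (at s) \<and> d \<le> 0"
      by (intro exI[of _ "r' s"] conjI dr nonpos)
  qed
  then have "exp (- 2 * B * t) * (p t \<bullet> p t) \<le> 0" using \<open>p 0 = 0\<close> by (simp add: r_def)
  then have "p t \<bullet> p t \<le> 0" by (simp add: mult_le_0_iff)
  then show ?thesis by (metis inner_gt_zero_iff not_le)
qed

lemma norm_linear_le_sum_Basis:
  assumes "linear f"
  shows "norm (f w) \<le> norm w * (\<Sum>b\<in>Basis. norm (f b))"
proof -
  have "f w = f (\<Sum>b\<in>Basis. (w \<bullet> b) *\<^sub>R b)" by (simp add: euclidean_representation)
  then have "norm (f w) = norm (\<Sum>b\<in>Basis. (w \<bullet> b) *\<^sub>R f b)"
    by (simp add: linear_sum[OF assms] linear_scale[OF assms])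
  also have "\<dots> \<le> (\<Sum>b\<in>Basis. \<bar>w \<bullet> b\<bar> * norm (f b))"
    by (rule order_trans[OF norm_sum]) simp
  also have "\<dots> \<le> (\<Sum>b\<in>Basis. norm w * norm (f b))"
    by (intro sum_mono mult_right_mono Basis_le_norm) auto
  finally show ?thesis by (simp add: sum_distrib_left)
qed

context sphh_submersion
begin

text \<open>Along a segment with vertical initial velocity \<open>v\<close>, the horizontal part \<open>p\<close> of \<open>v\<close> satisfies
  the linear equation \<open>p' = (D\<^sub>p P) v\<close>, because \<open>P\<close> is constant in vertical directions.\<close>

lemma velocity_stays_vertical:
  assumes seg: "\<And>s. 0 \<le> s \<Longrightarrow> s \<le> 1 \<Longrightarrow> x + s *\<^sub>R v \<in> U"
    and v: "v \<in> vertical A \<phi> x" and t: "0 \<le> t" "t \<le> 1"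
  shows "v \<in> vertical A \<phi> (x + t *\<^sub>R v)"
proof -
  define y where "y s = x + s *\<^sub>R v" for s
  have y: "y s \<in> U" if "0 \<le> s" "s \<le> 1" for s using seg[OF that] by (simp add: y_def)
  have dy: "(y has_derivative (\<lambda>h. h *\<^sub>R v)) (at s)" for s
    unfolding y_def by (auto intro!: derivative_eq_intros)
  define K where "K z = (\<Sum>b\<in>Basis. norm (P.D z b v))" for z
  have "continuous_on {0..1} (\<lambda>s. K (y s))"
    unfolding K_def
  proof (intro continuous_on_sum continuous_on_norm)
    fix b :: 'a
    have "continuous_on U (\<lambda>z. P.D z b v)"
      unfolding P.D_def by (rule smooth_on_imp_continuous_on[OF smooth_on_frechet_derivative[OF smooth_P]])
    moreover have "continuous_on {0..1} y" unfolding y_def by (intro continuous_intros)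
    ultimately show "continuous_on {0..1} (\<lambda>s. P.D (y s) b v)"
      by (rule continuous_on_compose2) (use y in auto)
  qed
  then have "bounded ((\<lambda>s. K (y s)) ` {0..1})"
    by (intro compact_imp_bounded compact_continuous_image) auto
  then obtain B where "\<forall>k\<in>(\<lambda>s. K (y s)) ` {0..1}. norm k \<le> B" unfolding bounded_iff by blast
  then have B: "K (y s) \<le> B" if "0 \<le> s" "s \<le> 1" for s
    using that by (auto dest!: bspec[of _ _ s])
  have "P (y t) v = 0"
  proof (rule vanishing_by_gronwall[where p' = "\<lambda>s. P.D (y s) v v"])
    show "((\<lambda>s. P (y s) v) has_vector_derivative P.D (y s) v v) (at s)" if "0 \<le> s" "s \<le> t" for s
    proof -
      have ys: "y s \<in> U" using y that t by simp
      have "((\<lambda>s. P (y s) v) has_derivative (\<lambda>h. P.D (y s) (h *\<^sub>R v) v)) (at s)"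
        by (rule has_derivative_compose[OF dy P.has_derivative[OF ys]])
      then show ?thesis
        unfolding has_vector_derivative_def by (simp add: linear_scale[OF P.linear_D[OF ys]])
    qed
    show "norm (P.D (y s) v v) \<le> B * norm (P (y s) v)" if "0 \<le> s" "s \<le> t" for s
    proof -
      have ys: "y s \<in> U" using y that t by simp
      have "P.D (y s) v v = P.D (y s) (v - P (y s) v) v + P.D (y s) (P (y s) v) v"
        using linear_add[OF P.linear_D[OF ys, of v], of "v - P (y s) v" "P (y s) v"] by simp
      then have "P.D (y s) v v = P.D (y s) (P (y s) v) v"
        using DP_vertical[OF ys vertical_diff_P[OF ys]] by simp
      then have "norm (P.D (y s) v v) \<le> norm (P (y s) v) * K (y s)"
        unfolding K_def using norm_linear_le_sum_Basis[OF P.linear_D[OF ys]] by metis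
      also have "\<dots> \<le> norm (P (y s) v) * B"
        using B that t by (intro mult_left_mono) auto
      finally show ?thesis by (simp add: mult.commute)
    qed
    show "P (y 0) v = 0" using v seg[of 0] by (simp add: y_def vertical_iff_P)
  qed (use t in simp)
  then show ?thesis using seg[OF t] by (simp add: y_def vertical_iff_P)
qed

lemma constant_along_vertical_segment:
  assumes seg: "\<And>s. 0 \<le> s \<Longrightarrow> s \<le> 1 \<Longrightarrow> x + s *\<^sub>R v \<in> U" and v: "v \<in> vertical A \<phi> x"
  shows F_vertical_segment: "induced_F A \<phi> (x + v) = induced_F A \<phi> x"
    and phi_vertical_segment: "\<phi> (x + v) = \<phi> x"
proof -
  define y where "y s = x + s *\<^sub>R v" for s
  have y: "y s \<in> U" if "s \<in> {0..1}" for s using seg that by (simp add: y_def)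
  have vert: "v \<in> vertical A \<phi> (y s)" if "s \<in> {0..1}" for s
    using velocity_stays_vertical[OF seg v] that by (simp add: y_def)
  have dy: "(y has_derivative (\<lambda>h. h *\<^sub>R v)) (at s)" for s
    unfolding y_def by (auto intro!: derivative_eq_intros)
  show "induced_F A \<phi> (x + v) = induced_F A \<phi> x"
  proof
    fix w
    have "\<exists>c. \<forall>s\<in>{0..1}. induced_F A \<phi> (y s) w = c"
    proof (rule has_derivative_zero_constant)
      fix s :: real assume s: "s \<in> {0..1}"
      have "((\<lambda>s. induced_F A \<phi> (y s) w) has_derivative (\<lambda>h. F.D (y s) (h *\<^sub>R v) w)) (at s)"
        by (rule has_derivative_compose[OF dy F.has_derivative[OF y[OF s]]])
      moreover have "F.D (y s) (h *\<^sub>R v) w = 0" for h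
        using DF_vertical[OF y[OF s] vert[OF s]] by (simp add: linear_scale[OF F.linear_D[OF y[OF s]]])
      ultimately show "((\<lambda>s. induced_F A \<phi> (y s) w) has_derivative (\<lambda>h. 0)) (at s within {0..1})"
        by (simp add: has_derivative_at_withinI)
    qed simp
    then obtain c where "\<forall>s\<in>{0..1}. induced_F A \<phi> (y s) w = c" by blast
    then have "induced_F A \<phi> (y 1) w = induced_F A \<phi> (y 0) w" by simp
    then show "induced_F A \<phi> (x + v) w = induced_F A \<phi> x w" by (simp add: y_def)
  qed
  have "\<phi> (y 1) = \<phi> (y 0)"
  proof (rule connected_local_const[of "{0..1}"])
    show "\<forall>a\<in>{0..1}. \<forall>\<^sub>F b in at a within {0..1}. \<phi> (y a) = \<phi> (y b)"
    proof
      fix a :: real assume a: "a \<in> {0..1}"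
      obtain C where C: "C \<in> A" "\<phi> (y a) \<in> fst C" by (rule chart_around)
      have "continuous_on UNIV y" unfolding y_def by (intro continuous_intros)
      then have "open (y -` (U \<inter> \<phi> -` fst C))"
        by (rule open_vimage[OF open_chart_preimage[OF C(1)]])
      moreover have "a \<in> y -` (U \<inter> \<phi> -` fst C)" using y[OF a] C by simp
      ultimately obtain e where e: "e > 0" "ball a e \<subseteq> y -` (U \<inter> \<phi> -` fst C)"
        using open_contains_ball by blast
      let ?I = "ball a e \<inter> {0..1}"
      have "\<exists>c. \<forall>s\<in>?I. (snd C \<circ> \<phi>) (y s) = c"
      proof (rule has_derivative_zero_constant)
        fix s assume s: "s \<in> ?I"
        then have ys: "y s \<in> U" "\<phi> (y s) \<in> fst C" using e by auto
        have "((\<lambda>s. (snd C \<circ> \<phi>) (y s)) has_derivative (\<lambda>h. dphi C (y s) (h *\<^sub>R v))) (at s)"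
          by (rule has_derivative_compose[OF dy has_derivative_chart_phi[OF C(1) ys]])
        moreover have "dphi C (y s) (h *\<^sub>R v) = 0" for h
          using vert[of s] s vertical_eq_ker_dphi[OF C(1) ys]
          by (simp add: linear_scale[OF linear_dphi[OF C(1) ys]])
        ultimately show "((\<lambda>s. (snd C \<circ> \<phi>) (y s)) has_derivative (\<lambda>h. 0)) (at s within ?I)"
          by (simp add: has_derivative_at_withinI)
      qed (simp add: convex_Int)
      moreover have "a \<in> ?I" using e a by simp
      ultimately have eq: "snd C (\<phi> (y s)) = snd C (\<phi> (y a))" if "s \<in> ?I" for s
        using that by auto
      have "\<phi> (y a) = \<phi> (y s)" if "s \<in> ?I" for s
        using inj_onD[OF inj_on_chart[OF C(1)] eq[OF that]] e that C by auto
      then show "\<forall>\<^sub>F b in at a within {0..1}. \<phi> (y a) = \<phi> (y b)"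
        unfolding eventually_at using e(1) by (intro exI[of _ e]) (auto simp: dist_commute)
    qed
  qed auto
  then show "\<phi> (x + v) = \<phi> x" by (simp add: y_def)
qed

lemma norm_diff_P_le:
  assumes "x \<in> U" shows "norm (w - P x w) \<le> norm w"
proof -
  have "P x w \<bullet> (w - P x w) = 0"
    using P_symmetric[OF assms] by (simp add: linear_diff[OF linear_P[OF assms]] P_P[OF assms])
  then have "norm (w - P x w) * norm (w - P x w) = w \<bullet> (w - P x w)"
    by (simp add: inner_diff_left flip: dot_square_norm power2_eq_square)
  also have "\<dots> \<le> norm w * norm (w - P x w)" by (rule norm_cauchy_schwarz)
  finally show ?thesis by (cases "w - P x w = 0") auto
qed

text \<open>The map sending \<open>y\<close> to the lift of its chart coordinates plus the vertical component of \<open>y\<close> has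
  the identity as its derivative at \<open>x\<close>, hence is injective near \<open>x\<close>. On a fibre it only depends on
  the vertical component, and the affine subspace \<open>x + ker d\<phi>\<close> already provides a point of the fibre
  with that component.\<close>

lemma fibre_locally_affine:
  assumes x: "x \<in> U"
  obtains r where "r > 0" "ball x r \<subseteq> U"
    "\<And>x'. x' \<in> ball x r \<Longrightarrow> \<phi> x' = \<phi> x \<longleftrightarrow> x' - x \<in> vertical A \<phi> x"
    "\<And>x'. x' \<in> ball x r \<Longrightarrow> \<phi> x' = \<phi> x \<Longrightarrow> induced_F A \<phi> x' = induced_F A \<phi> x"
proof -
  obtain C where C: "C \<in> A" "\<phi> x \<in> fst C" by (rule chart_around)
  define S where "S = U \<inter> \<phi> -` fst C"
  have S: "open S" "x \<in> S" using open_chart_preimage[OF C(1)] C x by (auto simp: S_def)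
  define G where "G = horizontal_lift (dphi C x)"
  have linear_G: "linear G"
    unfolding G_def by (rule linear_horizontal_lift[OF linear_dphi[OF C(1) x C(2)] surj_dphi[OF C(1) x C(2)]])
  define f where "f y = G ((snd C \<circ> \<phi>) y) + (y - P x y)" for y
  define f' where "f' y v = G (dphi C y v) + (v - P x v)" for y v
  have lin_dphi: "linear (dphi C y)" if "y \<in> S" for y
    using that linear_dphi[OF C(1)] by (auto simp: S_def)
  obtain r where r: "r > 0" "ball x r \<subseteq> S" "inj_on f (ball x r)"
  proof (rule has_derivative_locally_injective[OF S(2,1) bounded_linear_ident, of f' f])
    show "(\<lambda>x. x) \<circ> f' x = id"
      by (simp add: f'_def G_def fun_eq_iff flip: P_eq_lift[OF C(1) x C(2)])
    show "(f has_derivative f' y) (at y)" if "y \<in> S" for y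
      unfolding f_def[abs_def] f'_def[abs_def]
    proof (intro has_derivative_add has_derivative_diff has_derivative_ident)
      show "((\<lambda>y. G ((snd C \<circ> \<phi>) y)) has_derivative (\<lambda>v. G (dphi C y v))) (at y)"
        using that by (intro bounded_linear.has_derivative[OF linear_G[unfolded linear_conv_bounded_linear]]
            has_derivative_chart_phi C) (auto simp: S_def)
      show "(P x has_derivative P x) (at y)"
        using linear_P[OF x] by (simp add: linear_imp_has_derivative)
    qed
    fix e :: real assume "e > 0"
    define k where "k y = (\<Sum>b\<in>Basis. norm (G (dphi C y b) - G (dphi C x b)))" for y
    have "continuous_on S k"
      unfolding k_def S_def
      by (intro continuous_on_sum continuous_on_norm continuous_on_diff continuous_on_const
          linear_continuous_on_compose[OF _ linear_G] smooth_on_imp_continuous_on smooth_dphi C)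
    then have "isCont k x" using S by (simp add: continuous_on_eq_continuous_at)
    then obtain d1 where d1: "d1 > 0" "\<And>y. dist y x < d1 \<Longrightarrow> \<bar>k y - k x\<bar> < e / 2"
      using \<open>e > 0\<close> unfolding continuous_at_eps_delta dist_real_def by (metis half_gt_zero)
    obtain d2 where d2: "d2 > 0" "\<And>y. dist y x < d2 \<Longrightarrow> y \<in> S"
      using S unfolding open_dist by blast
    have "onorm (\<lambda>v. f' y v - f' x v) < e" if "dist x y < min d1 d2" for y
    proof -
      have y: "y \<in> S" "k y < e / 2"
        using d1(2)[of y] d2(2)[of y] that by (auto simp: dist_commute k_def)
      have "linear (\<lambda>v. G (dphi C y v) - G (dphi C x v))"
        using linear_G lin_dphi[OF y(1)] lin_dphi[OF S(2)] by (simp add: linear_iff algebra_simps)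
      from norm_linear_le_sum_Basis[OF this]
      have "onorm (\<lambda>v. f' y v - f' x v) \<le> k y"
        by (intro onorm_bound) (auto simp: f'_def k_def sum_nonneg mult.commute)
      with y(2) \<open>e > 0\<close> show ?thesis by simp
    qed
    then show "\<exists>d>0. \<forall>y. dist x y < d \<longrightarrow> onorm (\<lambda>v. f' y v - f' x v) < e"
      using d1 d2 by (intro exI[of _ "min d1 d2"]) auto
  qed
  have "ball x r \<subseteq> U" using r by (auto simp: S_def)
  have fibre: "\<phi> (x + v) = \<phi> x" "induced_F A \<phi> (x + v) = induced_F A \<phi> x"
    if "norm v < r" "v \<in> vertical A \<phi> x" for v
  proof -
    have "x + s *\<^sub>R v \<in> U" if "0 \<le> s" "s \<le> 1" for s
    proof -
      have "s * norm v \<le> norm v" using that by (simp add: mult_left_le_one_le)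
      then have "x + s *\<^sub>R v \<in> ball x r" using \<open>norm v < r\<close> that by (simp add: dist_norm)
      with \<open>ball x r \<subseteq> U\<close> show ?thesis by blast
    qed
    from constant_along_vertical_segment[OF this that(2)]
    show "\<phi> (x + v) = \<phi> x" "induced_F A \<phi> (x + v) = induced_F A \<phi> x" by auto
  qed
  have converse: "x' - x \<in> vertical A \<phi> x" if x': "x' \<in> ball x r" and eq: "\<phi> x' = \<phi> x" for x'
  proof -
    define v where "v = (x' - x) - P x (x' - x)"
    have v: "v \<in> vertical A \<phi> x" unfolding v_def by (rule vertical_diff_P[OF x])
    have "norm v < r"
      using norm_diff_P_le[OF x, of "x' - x"] x' by (simp add: v_def dist_norm norm_minus_commute)
    have "P x (x + v) = P x x"
      using v by (simp add: vertical_iff_P[OF x] linear_add[OF linear_P[OF x]])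
    then have "x + v - P x (x + v) = x' - P x x'"
      by (simp add: v_def linear_diff[OF linear_P[OF x]])
    then have "f (x + v) = f x'"
      using fibre(1)[OF \<open>norm v < r\<close> v] eq by (simp add: f_def)
    then have "x + v = x'"
      using inj_onD[OF r(3)] x' \<open>norm v < r\<close> by (simp add: dist_norm)
    then show ?thesis using v by auto
  qed
  show ?thesis
  proof (rule that[OF r(1) \<open>ball x r \<subseteq> U\<close>])
    fix x' assume x': "x' \<in> ball x r"
    then have n: "norm (x' - x) < r" by (simp add: dist_norm norm_minus_commute)
    show iff: "\<phi> x' = \<phi> x \<longleftrightarrow> x' - x \<in> vertical A \<phi> x"
      using converse[OF x'] fibre(1)[OF n] by auto
    show "induced_F A \<phi> x' = induced_F A \<phi> x" if "\<phi> x' = \<phi> x"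
      using fibre(2)[OF n] that iff by simp
  qed
qed

text \<open>The pair \<open>(F, P x)\<close> is locally constant along a fibre, and the second entry separates the
  different translates of the vertical space.\<close>

lemma fibre_component:
  assumes x: "x \<in> U" and x': "x' \<in> connected_component_set (fibre U \<phi> (\<phi> x)) x"
  shows fibre_component_F: "induced_F A \<phi> x' = induced_F A \<phi> x"
    and fibre_component_diff: "x' - x \<in> vertical A \<phi> x"
proof -
  let ?C = "connected_component_set (fibre U \<phi> (\<phi> x)) x"
  have C: "y \<in> U" "\<phi> y = \<phi> x" if "y \<in> ?C" for y
    using that connected_component_subset[of "fibre U \<phi> (\<phi> x)" x] by (auto simp: fibre_def)
  have "x \<in> ?C" using x by (simp add: fibre_def connected_component_refl)
  have "(induced_F A \<phi> x', P x' x') = (induced_F A \<phi> x, P x x)"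
  proof (rule connected_local_const[OF connected_connected_component x' \<open>x \<in> ?C\<close>], rule ballI)
    fix a assume a: "a \<in> ?C"
    obtain r where r: "r > 0" "ball a r \<subseteq> U"
      "\<And>x'. x' \<in> ball a r \<Longrightarrow> \<phi> x' = \<phi> a \<longleftrightarrow> x' - a \<in> vertical A \<phi> a"
      "\<And>x'. x' \<in> ball a r \<Longrightarrow> \<phi> x' = \<phi> a \<Longrightarrow> induced_F A \<phi> x' = induced_F A \<phi> a"
      using fibre_locally_affine[OF C(1)[OF a]] by blast
    have "(induced_F A \<phi> a, P a a) = (induced_F A \<phi> b, P b b)" if b: "b \<in> ?C" "b \<in> ball a r" for b
    proof -
      have "\<phi> b = \<phi> a" using C a b by simp
      then have "induced_F A \<phi> b = induced_F A \<phi> a" "P a (b - a) = 0"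
        using r b C(1)[OF a] by (auto simp: vertical_iff_P)
      then show ?thesis by (simp add: linear_diff[OF linear_P[OF C(1)[OF a]]]) (simp add: P_def)
    qed
    then show "\<forall>\<^sub>F b in at a within ?C. (induced_F A \<phi> a, P a a) = (induced_F A \<phi> b, P b b)"
      unfolding eventually_at using r(1) by (intro exI[of _ r]) (auto simp: dist_commute)
  qed
  then have eq: "induced_F A \<phi> x' = induced_F A \<phi> x" "P x' x' = P x x" by auto
  then show "induced_F A \<phi> x' = induced_F A \<phi> x" by simp
  have "P x' = P x" using eq(1) by (simp add: P_def fun_eq_iff)
  then show "x' - x \<in> vertical A \<phi> x"
    using x eq(2) by (simp add: vertical_iff_P linear_diff[OF linear_P])
qed

text \<open>A ball around a point of \<open>Z\<close> meets the translate of the vertical space in a convex, hence connected,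
  part of the fibre, which therefore lies in the component of that point. Both a component and,
  if it lies in one translate, the whole fibre are such sets \<open>Z\<close>.\<close>

lemma fibre_piece_openin:
  assumes x: "x \<in> U"
    and sub: "\<And>y. y \<in> Z \<Longrightarrow> y \<in> U \<and> \<phi> y = \<phi> x \<and> y - x \<in> vertical A \<phi> x \<and>
      vertical A \<phi> y = vertical A \<phi> x"
    and sat: "\<And>y. y \<in> Z \<Longrightarrow> connected_component_set (fibre U \<phi> (\<phi> x)) y \<subseteq> Z"
  shows "openin (top_of_set ((\<lambda>v. x + v) ` vertical A \<phi> x)) Z"
  unfolding openin_contains_ball
proof (intro conjI ballI)
  show "Z \<subseteq> (\<lambda>v. x + v) ` vertical A \<phi> x"
    using sub by (force simp: image_iff)
  fix y assume y: "y \<in> Z"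
  then have yU: "y \<in> U" "\<phi> y = \<phi> x" "y - x \<in> vertical A \<phi> x" "vertical A \<phi> y = vertical A \<phi> x"
    using sub by auto
  obtain r where r: "r > 0" "ball y r \<subseteq> U"
      "\<And>x'. x' \<in> ball y r \<Longrightarrow> \<phi> x' = \<phi> y \<longleftrightarrow> x' - y \<in> vertical A \<phi> y"
    using fibre_locally_affine[OF yU(1)] by metis
  let ?B = "ball y r \<inter> (\<lambda>v. x + v) ` vertical A \<phi> x"
  have "?B \<subseteq> fibre U \<phi> (\<phi> x)"
  proof
    fix z assume z: "z \<in> ?B"
    then obtain v where v: "z = x + v" "v \<in> vertical A \<phi> x" by blast
    have "z - y = v - (y - x)" by (simp add: v)
    also have "\<dots> \<in> vertical A \<phi> x" by (rule subspace_diff[OF subspace_vertical[OF x] v(2) yU(3)])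
    finally show "z \<in> fibre U \<phi> (\<phi> x)" using r z yU by (auto simp: fibre_def)
  qed
  moreover have "connected ?B"
    by (intro convex_connected convex_Int convex_ball convex_translation subspace_imp_convex
        subspace_vertical x)
  moreover have "y \<in> ?B" using r yU by (force simp: image_iff)
  ultimately have "?B \<subseteq> connected_component_set (fibre U \<phi> (\<phi> x)) y"
    by (intro connected_component_maximal)
  with sat[OF y] r(1) show "\<exists>e>0. ball y e \<inter> (\<lambda>v. x + v) ` vertical A \<phi> x \<subseteq> Z" by blast
qed

lemma fibre_component_openin:
  assumes x: "x \<in> U"
  shows "openin (top_of_set ((\<lambda>v. x + v) ` vertical A \<phi> x))
    (connected_component_set (fibre U \<phi> (\<phi> x)) x)"
proof (rule fibre_piece_openin[OF x])
  fix y assume y: "y \<in> connected_component_set (fibre U \<phi> (\<phi> x)) x"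
  then have "y \<in> U" "\<phi> y = \<phi> x"
    using connected_component_subset[of "fibre U \<phi> (\<phi> x)" x] by (auto simp: fibre_def)
  then show "y \<in> U \<and> \<phi> y = \<phi> x \<and> y - x \<in> vertical A \<phi> x \<and> vertical A \<phi> y = vertical A \<phi> x"
    using fibre_component[OF x y] x by (simp add: vertical_eq_ker_F)
  show "connected_component_set (fibre U \<phi> (\<phi> x)) y \<subseteq> connected_component_set (fibre U \<phi> (\<phi> x)) x"
    using connected_component_eq[OF y] by simp
qed

end

section \<open>Holomorphic maps on the target, seen on the source\<close>

context smooth_submersion
begin

text \<open>The Cauchy--Riemann equations in the horizontal directions.\<close>

definition CR_at :: "'a \<Rightarrow> ('a \<Rightarrow> complex) \<Rightarrow> bool" where
  "CR_at x f \<longleftrightarrow> (\<exists>L. (f has_derivative L) (at x) \<and>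
     (\<forall>u. P x u = u \<longrightarrow> L (induced_F A \<phi> x u) = \<i> * L u))"

lemma CR_atI:
  assumes "(f has_derivative L) (at x)"
    and "\<And>u. P x u = u \<Longrightarrow> L (induced_F A \<phi> x u) = \<i> * L u"
  shows "CR_at x f"
  using assms unfolding CR_at_def by blast

lemma CR_atE:
  assumes "CR_at x f"
  obtains L where "(f has_derivative L) (at x)"
    "\<And>u. P x u = u \<Longrightarrow> L (induced_F A \<phi> x u) = \<i> * L u"
  using assms unfolding CR_at_def by blast

lemma CR_at_cong:
  assumes "CR_at x f" "open S" "x \<in> S" "\<And>y. y \<in> S \<Longrightarrow> f y = g y"
  shows "CR_at x g"
  using assms(1) by (rule CR_atE)
    (rule CR_atI, rule has_derivative_transform_within_open[OF _ assms(2-4)])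

lemma CR_at_const: "CR_at x (\<lambda>y. c)"
  by (rule CR_atI[OF has_derivative_const]) simp

lemma CR_at_add:
  assumes "CR_at x f" "CR_at x g"
  shows "CR_at x (\<lambda>y. f y + g y)"
proof -
  obtain L where L: "(f has_derivative L) (at x)"
    "\<And>u. P x u = u \<Longrightarrow> L (induced_F A \<phi> x u) = \<i> * L u" using assms(1) by (rule CR_atE) blast
  obtain M where M: "(g has_derivative M) (at x)"
    "\<And>u. P x u = u \<Longrightarrow> M (induced_F A \<phi> x u) = \<i> * M u" using assms(2) by (rule CR_atE) blast
  show ?thesis by (rule CR_atI[OF has_derivative_add[OF L(1) M(1)]]) (simp add: L M algebra_simps)
qed

lemma CR_at_mult:
  assumes "CR_at x f" "CR_at x g"
  shows "CR_at x (\<lambda>y. f y * g y)"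
proof -
  obtain L where L: "(f has_derivative L) (at x)"
    "\<And>u. P x u = u \<Longrightarrow> L (induced_F A \<phi> x u) = \<i> * L u" using assms(1) by (rule CR_atE) blast
  obtain M where M: "(g has_derivative M) (at x)"
    "\<And>u. P x u = u \<Longrightarrow> M (induced_F A \<phi> x u) = \<i> * M u" using assms(2) by (rule CR_atE) blast
  show ?thesis by (rule CR_atI[OF has_derivative_mult[OF L(1) M(1)]]) (simp add: L M algebra_simps)
qed

lemma CR_at_inverse:
  assumes "CR_at x f" "f x \<noteq> 0"
  shows "CR_at x (\<lambda>y. inverse (f y))"
proof -
  obtain L where L: "(f has_derivative L) (at x)"
    "\<And>u. P x u = u \<Longrightarrow> L (induced_F A \<phi> x u) = \<i> * L u" using assms(1) by (rule CR_atE) blast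
  show ?thesis
    by (rule CR_atI[OF Deriv.has_derivative_inverse[OF assms(2) L(1)]]) (simp add: L)
qed

lemma CR_at_sum:
  assumes "\<And>i. i \<in> I \<Longrightarrow> CR_at x (f i)"
  shows "CR_at x (\<lambda>y. \<Sum>i\<in>I. f i y)"
  using assms
proof (induction I rule: infinite_finite_induct)
  case (insert i I)
  then show ?case using CR_at_add[of x "f i" "\<lambda>y. \<Sum>i\<in>I. f i y"] by simp
qed (simp_all add: CR_at_const)

lemma CR_at_prod:
  assumes "\<And>i. i \<in> I \<Longrightarrow> CR_at x (f i)"
  shows "CR_at x (\<lambda>y. \<Prod>i\<in>I. f i y)"
  using assms
proof (induction I rule: infinite_finite_induct)
  case (insert i I)
  then show ?case using CR_at_mult[of x "f i" "\<lambda>y. \<Prod>i\<in>I. f i y"] by simp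
qed (simp_all add: CR_at_const)

lemma CR_at_det:
  fixes M :: "'a \<Rightarrow> complex^'k^'k"
  assumes "\<And>i j. CR_at x (\<lambda>y. M y $ i $ j)"
  shows "CR_at x (\<lambda>y. det (M y))"
  unfolding det_def
proof (rule CR_at_sum)
  fix p :: "'k \<Rightarrow> 'k"
  have "CR_at x (\<lambda>y. \<Prod>i\<in>UNIV. M y $ i $ p i)" by (rule CR_at_prod) (rule assms)
  from CR_at_mult[OF CR_at_const this]
  show "CR_at x (\<lambda>y. of_int (sign p) * (\<Prod>i\<in>UNIV. M y $ i $ p i))" .
qed

text \<open>The restriction of \<open>\<phi>\<close> to the horizontal affine space through \<open>x\<close>, read in the chart, has an
  invertible derivative at \<open>x\<close>, so the inverse function theorem applies.\<close>

lemma local_section: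
  assumes C: "C \<in> A" "x \<in> U" "\<phi> x \<in> fst C"
  obtains Z s where "open Z" "snd C (\<phi> x) \<in> Z" "s (snd C (\<phi> x)) = x" "continuous_on Z s"
    "(s has_derivative horizontal_lift (dphi C x)) (at (snd C (\<phi> x)))"
    "\<And>z. z \<in> Z \<Longrightarrow> s z \<in> U" "\<And>z. z \<in> Z \<Longrightarrow> \<phi> (s z) \<in> fst C" "\<And>z. z \<in> Z \<Longrightarrow> snd C (\<phi> (s z)) = z"
proof -
  define S where "S = U \<inter> \<phi> -` fst C"
  have S: "open S" "x \<in> S" using open_chart_preimage[OF C(1)] C by (auto simp: S_def)
  define G where "G = horizontal_lift (dphi C x)"
  note T = linear_dphi[OF C] surj_dphi[OF C]
  have lin_G: "linear G" unfolding G_def by (rule linear_horizontal_lift[OF T])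
  define z0 where "z0 = snd C (\<phi> x)"
  define q where "q w = x + G (w - z0)" for w
  have dq: "(q has_derivative G) (at w)" for w
  proof -
    have "((\<lambda>w. G (w - z0)) has_derivative (\<lambda>v. G (v - 0))) (at w)"
      by (intro bounded_linear.has_derivative[OF lin_G[unfolded linear_conv_bounded_linear]]
          has_derivative_diff has_derivative_ident has_derivative_const)
    from has_derivative_add[OF has_derivative_const this] show ?thesis unfolding q_def by simp
  qed
  have cont_q: "continuous_on W q" for W
    using dq by (meson continuous_at_imp_continuous_on has_derivative_continuous)
  define W where "W = q -` S"
  have "open W" unfolding W_def by (rule open_vimage[OF S(1) cont_q])
  have q0: "q z0 = x" by (simp add: q_def linear_0[OF lin_G])
  then have "z0 \<in> W" using S by (simp add: W_def)
  have qS: "q w \<in> U" "\<phi> (q w) \<in> fst C" if "w \<in> W" for w using that by (auto simp: W_def S_def)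
  define h where "h w = snd C (\<phi> (q w))" for w
  define h' where "h' w = Blinfun (\<lambda>v. dphi C (q w) (G v))" for w
  have h': "blinfun_apply (h' w) = (\<lambda>v. dphi C (q w) (G v))" if "w \<in> W" for w
  proof -
    have "linear (\<lambda>v. dphi C (q w) (G v))"
      using linear_compose[OF lin_G linear_dphi[OF C(1) qS[OF that]]] by (simp add: o_def)
    then show ?thesis
      unfolding h'_def by (intro bounded_linear_Blinfun_apply) (simp add: linear_conv_bounded_linear)
  qed
  have der: "(h has_derivative blinfun_apply (h' w)) (at w)" if "w \<in> W" for w
    unfolding h'[OF that] h_def
    using has_derivative_compose[OF dq has_derivative_chart_phi[OF C(1) qS[OF that]]] by simp
  have cont: "continuous_on W h'"
  proof (rule continuous_on_blinfun_componentwise)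
    fix v
    have "continuous_on S (\<lambda>y. dphi C y (G v))"
      unfolding S_def by (rule smooth_on_imp_continuous_on[OF smooth_dphi[OF C(1)]])
    then have "continuous_on W (\<lambda>w. dphi C (q w) (G v))"
      by (rule continuous_on_compose2[OF _ cont_q]) (auto simp: W_def)
    then show "continuous_on W (\<lambda>w. blinfun_apply (h' w) v)"
      by (rule continuous_on_eq) (simp add: h')
  qed
  have id: "blinfun_apply (h' z0) v = v" for v
    using h'[OF \<open>z0 \<in> W\<close>] horizontal_lift_right_inverse[OF T] by (simp add: q0 G_def)
  have "id_blinfun o\<^sub>L h' z0 = id_blinfun" by (rule blinfun_eqI) (simp add: id)
  from inverse_function_theorem[OF \<open>open W\<close> der cont \<open>z0 \<in> W\<close> this]
  obtain U' V g g' where inv: "open U'" "U' \<subseteq> W" "z0 \<in> U'" "open V" "h z0 \<in> V" "homeomorphism U' V h g"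
    "\<And>y. y \<in> V \<Longrightarrow> (g has_derivative g' y) (at y)"
    "\<And>y. y \<in> V \<Longrightarrow> g' y = inv (blinfun_apply (h' (g y)))" by metis
  have h0: "h z0 = z0" by (simp add: h_def q0) (simp add: z0_def)
  have g0: "g z0 = z0" using homeomorphism_apply1[OF inv(6) inv(3)] h0 by simp
  have "blinfun_apply (h' z0) = id" using id by auto
  then have "(g has_derivative id) (at z0)"
    using inv(7)[of z0] inv(8)[of z0] inv(5) by (simp add: h0 g0)
  from has_derivative_compose[OF this dq]
  have ds: "((\<lambda>z. q (g z)) has_derivative G) (at z0)" by (simp add: g0)
  have gW: "g z \<in> W" if "z \<in> V" for z
    using homeomorphism_image2[OF inv(6)] inv(2) that by blast
  show ?thesis
  proof (rule that[of V "\<lambda>z. q (g z)", folded z0_def G_def, OF inv(4) _ _ _ ds])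
    show "z0 \<in> V" using inv(5) h0 by simp
    show "q (g z0) = x" using g0 q0 by simp
    show "continuous_on V (\<lambda>z. q (g z))"
      by (rule continuous_on_compose2[OF cont_q homeomorphism_cont2[OF inv(6)]]) auto
    show "q (g z) \<in> U" "\<phi> (q (g z)) \<in> fst C" if "z \<in> V" for z
      using qS gW[OF that] by auto
    show "snd C (\<phi> (q (g z))) = z" if "z \<in> V" for z
      using homeomorphism_apply2[OF inv(6) that] by (simp add: h_def)
  qed
qed

text \<open>Local sections are continuous, so every point near \<open>\<phi> x\<close> is the image of a point near \<open>x\<close>.\<close>

lemma open_image_phi:
  assumes B: "open B" "B \<subseteq> U"
  shows "open (\<phi> ` B)"
  unfolding open_subopen[of "\<phi> ` B"]
proof
  fix y assume "y \<in> \<phi> ` B"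
  then obtain x where x: "x \<in> B" "y = \<phi> x" by blast
  obtain C where C: "C \<in> A" "\<phi> x \<in> fst C" by (rule chart_around)
  have "x \<in> U" using x B by blast
  obtain Z s where s: "open Z" "snd C (\<phi> x) \<in> Z" "s (snd C (\<phi> x)) = x" "continuous_on Z s"
    "\<And>z. z \<in> Z \<Longrightarrow> \<phi> (s z) \<in> fst C" "\<And>z. z \<in> Z \<Longrightarrow> snd C (\<phi> (s z)) = z"
    using local_section[OF C(1) \<open>x \<in> U\<close> C(2)] by metis
  have "open (Z \<inter> s -` B)" by (rule continuous_open_preimage[OF s(4,1) B(1)])
  then have "open (fst C \<inter> snd C -` (Z \<inter> s -` B))"
    by (rule continuous_open_preimage[OF homeomorphism_cont1[OF homeomorphism_chart[OF C(1)]]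
          open_chart_domain[OF C(1)]])
  moreover have "y \<in> fst C \<inter> snd C -` (Z \<inter> s -` B)" using x C s by simp
  moreover have "fst C \<inter> snd C -` (Z \<inter> s -` B) \<subseteq> \<phi> ` B"
  proof
    fix y' assume y': "y' \<in> fst C \<inter> snd C -` (Z \<inter> s -` B)"
    then have "\<phi> (s (snd C y')) = y'"
      using inj_onD[OF inj_on_chart[OF C(1)] s(6)] s(5) by simp
    with y' show "y' \<in> \<phi> ` B" by (metis IntD2 imageI vimageD)
  qed
  ultimately show "\<exists>T. open T \<and> y \<in> T \<and> T \<subseteq> \<phi> ` B" by blast
qed

lemma has_derivative_vec_componentwise:
  fixes f :: "'c::real_normed_vector \<Rightarrow> complex^'k"
  assumes "\<And>i. ((\<lambda>x. f x $ i) has_derivative L i) (at x)"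
  shows "(f has_derivative (\<lambda>v. \<chi> i. L i v)) (at x)"
proof (subst has_derivative_componentwise_within, rule ballI)
  fix b :: "complex^'k" assume "b \<in> Basis"
  then obtain i c where b: "b = axis i c" by (auto simp: Basis_vec_def)
  show "((\<lambda>x. f x \<bullet> b) has_derivative (\<lambda>v. (\<chi> i. L i v) \<bullet> b)) (at x)"
    unfolding b inner_axis vec_lambda_beta by (rule has_derivative_inner_left[OF assms])
qed

text \<open>In a chart, a function on the target is locally its composition with \<open>\<phi>\<close> and a local section
  with horizontal derivative at the given point.\<close>

lemma holomorphic_map_onI:
  fixes f :: "'b \<Rightarrow> complex^'k"
  assumes "\<And>y. y \<in> W \<Longrightarrow> \<exists>x\<in>U. \<phi> x = y \<and> (\<forall>i. CR_at x (\<lambda>x. f (\<phi> x) $ i))"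
  shows "holomorphic_map_on A W f"
  unfolding holomorphic_map_on_def cholomorphic_on_def
proof (intro ballI, unfold split_paired_all, clarify)
  fix D c y assume C': "(D, c) \<in> A" and y: "y \<in> D" "y \<in> W"
  define C where "C = (D, c)"
  have C: "C \<in> A" "D = fst C" "c = snd C" using C' by (auto simp: C_def)
  obtain x where x: "x \<in> U" "\<phi> x = y" and CR: "\<And>i. CR_at x (\<lambda>x. f (\<phi> x) $ i)"
    using assms[OF y(2)] by blast
  have xC: "\<phi> x \<in> fst C" using x y C by simp
  note T = linear_dphi[OF C(1) x(1) xC] surj_dphi[OF C(1) x(1) xC]
  define G where "G = horizontal_lift (dphi C x)"
  obtain Z s where s: "open Z" "snd C (\<phi> x) \<in> Z" "s (snd C (\<phi> x)) = x"
    "(s has_derivative G) (at (snd C (\<phi> x)))"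
    "\<And>z. z \<in> Z \<Longrightarrow> \<phi> (s z) \<in> fst C" "\<And>z. z \<in> Z \<Longrightarrow> snd C (\<phi> (s z)) = z"
    using local_section[OF C(1) x(1) xC] unfolding G_def by metis
  have "\<forall>i. \<exists>L. ((\<lambda>x. f (\<phi> x) $ i) has_derivative L) (at x) \<and>
     (\<forall>u. P x u = u \<longrightarrow> L (induced_F A \<phi> x u) = \<i> * L u)"
    using CR unfolding CR_at_def by blast
  then obtain L where L: "\<And>i. ((\<lambda>x. f (\<phi> x) $ i) has_derivative L i) (at x)"
    "\<And>i u. P x u = u \<Longrightarrow> L i (induced_F A \<phi> x u) = \<i> * L i u" by metis
  define M where "M v = (\<chi> i. L i (G v))" for v
  have "((\<lambda>z. f (\<phi> (s z))) has_derivative M) (at (snd C (\<phi> x)))"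
    unfolding M_def
  proof (rule has_derivative_vec_componentwise)
    fix i
    show "((\<lambda>z. f (\<phi> (s z)) $ i) has_derivative (\<lambda>v. L i (G v))) (at (snd C (\<phi> x)))"
      by (rule has_derivative_compose[OF s(4), where g = "\<lambda>x. f (\<phi> x) $ i"]) (simp add: s(3) L(1))
  qed
  then have der: "((f \<circ> inv_into D c) has_derivative M) (at (c y))"
    unfolding x(2) C(3)
  proof (rule has_derivative_transform_within_open[OF _ s(1)])
    show "snd C y \<in> Z" using s(2) x by simp
    show "f (\<phi> (s z)) = (f \<circ> inv_into D (snd C)) z" if "z \<in> Z" for z
      using inv_into_f_f[OF inj_on_chart[OF C(1)] s(5)[OF that]] s(6)[OF that] by (simp add: C)
  qed
  have "M (\<i> *s w) = \<i> *s M w" for w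
  proof -
    have "P x (G w) = G w" "induced_F A \<phi> x (G w) = G (\<i> *s w)"
      using horizontal_lift_right_inverse[OF T]
      by (simp_all add: P_eq_lift[OF C(1) x(1) xC] induced_F_eq_lift[OF C(1) x(1) xC] G_def)
    then show ?thesis using L(2) by (simp add: M_def vec_eq_iff flip: \<open>induced_F A \<phi> x (G w) = _\<close>)
  qed
  then have "M (a *s w) = a *s M w" for a w
    by (rule linear_i_imp_complex_linear[OF has_derivative_linear[OF der]])
  with der show "\<exists>L. ((f \<circ> inv_into D c) has_derivative L) (at (c y)) \<and> (\<forall>a v. L (a *s v) = a *s L v)"
    by blast
qed

lemma holomorphic_map_on_imp_CR_at:
  fixes f :: "'b \<Rightarrow> complex^'k"
  assumes f: "holomorphic_map_on A W f" and W: "open W" and x: "x \<in> U" "\<phi> x \<in> W"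
  shows "CR_at x (\<lambda>x. f (\<phi> x) $ i)"
proof -
  obtain C where C: "C \<in> A" "\<phi> x \<in> fst C" by (rule chart_around)
  have "cholomorphic_on (f \<circ> inv_into (fst C) (snd C)) (snd C ` (fst C \<inter> W))"
    using f C(1) unfolding holomorphic_map_on_def by (cases C) auto
  moreover have "(snd C \<circ> \<phi>) x \<in> snd C ` (fst C \<inter> W)" using C x by auto
  ultimately obtain L where L: "((f \<circ> inv_into (fst C) (snd C)) has_derivative L) (at ((snd C \<circ> \<phi>) x))"
    "\<And>a v. L (a *s v) = a *s L v"
    unfolding cholomorphic_on_def by blast
  have "((\<lambda>y. (f \<circ> inv_into (fst C) (snd C)) ((snd C \<circ> \<phi>) y)) has_derivative (\<lambda>v. L (dphi C x v))) (at x)"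
    by (rule has_derivative_compose[OF has_derivative_chart_phi[OF C(1) x(1) C(2)] L(1)])
  then have "((\<lambda>y. f (\<phi> y)) has_derivative (\<lambda>v. L (dphi C x v))) (at x)"
  proof (rule has_derivative_transform_within_open[OF _ open_chart_preimage[OF C(1)]])
    show "x \<in> U \<inter> \<phi> -` fst C" using C x by simp
    show "(f \<circ> inv_into (fst C) (snd C)) ((snd C \<circ> \<phi>) y) = f (\<phi> y)" if "y \<in> U \<inter> \<phi> -` fst C" for y
      using inv_into_f_f[OF inj_on_chart[OF C(1)]] that by simp
  qed
  from bounded_linear.has_derivative[OF bounded_linear_vec_nth this]
  show ?thesis by (rule CR_atI) (simp add: dphi_F[OF C(1) x(1) C(2)] L(2))
qed

end

lemma (in sphh_submersion) CR_at_dphi: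
  assumes C: "C \<in> A" "x \<in> U" "\<phi> x \<in> fst C"
  shows "CR_at x (\<lambda>y. dphi C y v $ i)"
proof -
  interpret T: operator_field "U \<inter> \<phi> -` fst C" "dphi C" by (rule operator_field_dphi[OF C(1)])
  have x: "x \<in> U \<inter> \<phi> -` fst C" using C by simp
  from bounded_linear.has_derivative[OF bounded_linear_vec_nth T.has_derivative[OF x]]
  show ?thesis by (rule CR_atI) (simp add: hessian_complex_linear_left[OF C])
qed

section \<open>Normalized coordinates of the fibres of the quotient bundle\<close>

lemma (in complex_coordinates) complex_coordinates_matrix:
  assumes "M ** N = mat 1" "N ** M = mat 1"
  shows "complex_coordinates F (\<lambda>v. M *v T v)"
proof (rule complex_coordinates.intro[OF linear_F])
  show "linear (\<lambda>v. M *v T v)"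
    by (rule linearI)
      (simp_all add: linear_add[OF linear_T] linear_scale[OF linear_T] matrix_vector_right_distrib
        scaleR_eq_vec_smult vector_scalar_commute)
  show "surj (\<lambda>v. M *v T v)"
  proof (rule surjI)
    show "M *v T (inv T (N *v w)) = w" for w
      by (simp add: surj_f_inv_f[OF surj_T] matrix_vector_mul_assoc assms)
  qed
  show "M *v T (F v) = \<i> *s (M *v T v)" for v by (simp add: T_F vector_scalar_commute)
  fix v assume "M *v T v = 0"
  then have "N *v (M *v T v) = 0" by simp
  then have "T v = 0" by (simp add: matrix_vector_mul_assoc assms)
  then show "F v = 0" by (rule F_eq_0)
qed

text \<open>The components of \<open>T'\<close> are complex-linear functionals, hence combinations of the components of \<open>T\<close>;
  the values on the vectors \<open>e i\<close> identify the coefficients.\<close>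

lemma complex_coordinates_unique:
  assumes T: "complex_coordinates F T" and T': "complex_coordinates F' T'"
    and eq: "complex_functionals F = complex_functionals F'"
    and e: "\<And>i. T (e i) = axis i 1" "\<And>i. T' (e i) = axis i 1"
  shows "T = T'"
proof
  fix v
  have "T' v $ k = T v $ k" for k
  proof -
    have "(\<lambda>v. T' v $ k) \<in> complex_functionals F"
      unfolding eq by (rule complex_coordinates.component_in_complex_functionals[OF T'])
    from complex_coordinates.complex_functional_expansion[OF T this e(1), of v]
    moreover have "T' (e i) $ k * T v $ i = (if i = k then T v $ k else 0)" for i
      by (simp add: e axis_def)
    ultimately show ?thesis by simp
  qed
  then show "T v = T' v" by (simp add: vec_eq_iff)
qed

context sphh_submersion
begin

definition frame_matrix :: "('b, 'n) chart \<Rightarrow> ('n \<Rightarrow> 'a) \<Rightarrow> 'a \<Rightarrow> complex^'n^'n" where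
  "frame_matrix C e x = (\<chi> i j. dphi C x (e j) $ i)"

text \<open>Cramer's rule for the coordinates \<open>N\<^sup>-\<^sup>1 T\<close>, where \<open>N\<close> is the frame matrix.\<close>

definition frame_coord :: "('b, 'n) chart \<Rightarrow> ('n \<Rightarrow> 'a) \<Rightarrow> 'a \<Rightarrow> 'a \<Rightarrow> complex^'n" where
  "frame_coord C e x v =
     (\<chi> k. det (\<chi> i j. if j = k then dphi C x v $ i else frame_matrix C e x $ i $ j) / det (frame_matrix C e x))"

definition frame_domain :: "('b, 'n) chart \<Rightarrow> ('n \<Rightarrow> 'a) \<Rightarrow> 'a set" where
  "frame_domain C e = {x \<in> U \<inter> \<phi> -` fst C. det (frame_matrix C e x) \<noteq> 0}"

lemma open_frame_domain:
  assumes "C \<in> A" shows "open (frame_domain C e)"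
proof -
  let ?S = "U \<inter> \<phi> -` fst C"
  have S: "open ?S" by (rule open_chart_preimage[OF assms])
  have "smooth_on ?S (\<lambda>x. det (frame_matrix C e x))"
  proof (rule smooth_on_det[OF S])
    show "smooth_on ?S (\<lambda>x. frame_matrix C e x $ i $ j)" for i j
      unfolding frame_matrix_def vec_lambda_beta
      by (rule smooth_on_bounded_linear[OF S bounded_linear_vec_nth smooth_dphi[OF assms]])
  qed
  then have "open (?S \<inter> (\<lambda>x. det (frame_matrix C e x)) -` (- {0}))"
    by (intro continuous_open_preimage[OF smooth_on_imp_continuous_on S]) auto
  moreover have "?S \<inter> (\<lambda>x. det (frame_matrix C e x)) -` (- {0}) = frame_domain C e"
    by (auto simp: frame_domain_def)
  ultimately show ?thesis by simp
qed

lemma frame_coord: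
  assumes C: "C \<in> A" and x: "x \<in> frame_domain C e"
  shows complex_coordinates_frame_coord: "complex_coordinates (induced_F A \<phi> x) (frame_coord C e x)"
    and frame_coord_frame: "frame_coord C e x (e i) = axis i 1"
proof -
  have x': "x \<in> U" "\<phi> x \<in> fst C" and det: "det (frame_matrix C e x) \<noteq> 0"
    using x by (auto simp: frame_domain_def)
  obtain M where M: "M ** frame_matrix C e x = mat 1" "frame_matrix C e x ** M = mat 1"
    using det unfolding invertible_det_nz[symmetric] invertible_def by blast
  have "frame_matrix C e x *v frame_coord C e x v = dphi C x v" for v
    using cramer[OF det, of "frame_coord C e x v" "dphi C x v"] by (simp add: frame_coord_def)
  then have "M *v (frame_matrix C e x *v frame_coord C e x v) = M *v dphi C x v" for v by simp
  then have eq: "frame_coord C e x v = M *v dphi C x v" for v by (simp add: matrix_vector_mul_assoc M)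
  then have "frame_coord C e x = (\<lambda>v. M *v dphi C x v)" by blast
  then show "complex_coordinates (induced_F A \<phi> x) (frame_coord C e x)"
    using complex_coordinates.complex_coordinates_matrix[OF complex_coordinates_dphi[OF C x'] M] by simp
  have "dphi C x (e j) $ k * axis i 1 $ j = (if j = i then dphi C x (e i) $ k else 0)" for j k
    by (simp add: axis_def)
  then have "dphi C x (e i) = frame_matrix C e x *v axis i 1"
    by (simp add: vec_eq_iff frame_matrix_def matrix_vector_mult_def)
  then show "frame_coord C e x (e i) = axis i 1" by (simp add: eq matrix_vector_mul_assoc M)
qed

lemma CR_at_frame_coord:
  assumes C: "C \<in> A" and x: "x \<in> frame_domain C e"
  shows "CR_at x (\<lambda>y. frame_coord C e y v $ k)"
  unfolding frame_coord_def vec_lambda_beta divide_inverse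
proof (rule CR_at_mult)
  have x': "x \<in> U" "\<phi> x \<in> fst C" "det (frame_matrix C e x) \<noteq> 0"
    using x by (auto simp: frame_domain_def)
  have CR: "CR_at x (\<lambda>y. frame_matrix C e y $ i $ j)" for i j
    unfolding frame_matrix_def vec_lambda_beta by (rule CR_at_dphi[OF C x'(1,2)])
  show "CR_at x (\<lambda>y. inverse (det (frame_matrix C e y)))"
    by (rule CR_at_inverse[OF CR_at_det[OF CR] x'(3)])
  have "CR_at x (\<lambda>y. (\<chi> i j. if j = k then dphi C y v $ i else frame_matrix C e y $ i $ j) $ i $ j)" for i j
    using CR CR_at_dphi[OF C x'(1,2)] by (cases "j = k") simp_all
  then show "CR_at x (\<lambda>y. det (\<chi> i j. if j = k then dphi C y v $ i else frame_matrix C e y $ i $ j))"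
    by (rule CR_at_det)
qed

section \<open>The quotient bundle and the position section\<close>

lemma Omega_eq: "x \<in> U \<Longrightarrow> Omega A \<phi> x = complex_functionals (induced_F A \<phi> x)"
  unfolding Omega_def using complex_coordinates.grass_point_eq[OF complex_coordinates_dphi]
  by (metis chart_around)

lemma Omega_properties:
  assumes x: "x \<in> U"
  shows Omega_in_orth_grassmannian: "Omega A \<phi> x \<in> orth_grassmannian CARD('n)"
    and univ_kernel_Omega: "univ_kernel (Omega A \<phi> x) = vertical A \<phi> x"
    and dim_vertical: "dim (vertical A \<phi> x) + 2 * CARD('n) = DIM('a)"
    and isotropic_quotient_Omega:
      "isotropic_quotient CARD('n) (univ_kernel (Omega A \<phi> x)) (univ_J (Omega A \<phi> x))"
    and univ_J_Omega: "univ_J (Omega A \<phi> x) (quot_map (vertical A \<phi> x) v)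
      = quot_map (vertical A \<phi> x) (induced_F A \<phi> x v)"
proof -
  obtain C where C: "C \<in> A" "\<phi> x \<in> fst C" by (rule chart_around)
  interpret complex_coordinates "induced_F A \<phi> x" "dphi C x"
    by (rule complex_coordinates_dphi[OF C(1) x C(2)])
  note skew = F_skew[OF x]
  show "Omega A \<phi> x \<in> orth_grassmannian CARD('n)"
    unfolding Omega_eq[OF x] by (rule complex_functionals_in_orth_grassmannian[OF skew])
  show "univ_kernel (Omega A \<phi> x) = vertical A \<phi> x"
    unfolding Omega_eq[OF x] vertical_eq_ker_F[OF x] by (rule univ_kernel_complex_functionals)
  show "dim (vertical A \<phi> x) + 2 * CARD('n) = DIM('a)"
    unfolding vertical_eq_ker_F[OF x] by (rule dim_ker_F)
  show "isotropic_quotient CARD('n) (univ_kernel (Omega A \<phi> x)) (univ_J (Omega A \<phi> x))"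
    unfolding Omega_eq[OF x] by (rule isotropic_quotient_complex_functionals[OF skew])
  show "univ_J (Omega A \<phi> x) (quot_map (vertical A \<phi> x) v)
      = quot_map (vertical A \<phi> x) (induced_F A \<phi> x v)"
    unfolding Omega_eq[OF x] vertical_eq_ker_F[OF x] by (rule univ_J_complex_functionals)
qed

lemma Omega_fibre_component:
  assumes "x \<in> U" "x' \<in> connected_component_set (fibre U \<phi> (\<phi> x)) x"
  shows "Omega A \<phi> x' = Omega A \<phi> x"
  using fibre_component_F[OF assms] by (simp add: Omega_def)

text \<open>A connected fibre is a single component, on which \<open>\<Omega>\<close> and the class of the position vector are
  constant; both can be read off at an arbitrarily chosen point of the fibre.\<close>

lemma connected_fibres_factorization:
  assumes conn: "\<And>y. connected (fibre U \<phi> y)"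
  shows "\<exists>\<omega> \<sigma>. factors_Omega A U \<phi> \<omega> \<and> position_section U \<phi> \<omega> \<sigma>"
proof -
  define s where "s y = (SOME x. x \<in> U \<and> \<phi> x = y)" for y
  define \<omega> where "\<omega> y = Omega A \<phi> (s y)" for y
  define \<sigma> where "\<sigma> y = Q_tau \<omega> y (s y)" for y
  have comp: "s (\<phi> x) \<in> connected_component_set (fibre U \<phi> (\<phi> x)) x" if "x \<in> U" for x
  proof -
    have "s (\<phi> x) \<in> fibre U \<phi> (\<phi> x)"
      using someI[of "\<lambda>z. z \<in> U \<and> \<phi> z = \<phi> x" x] that by (simp add: s_def fibre_def)
    moreover have "x \<in> fibre U \<phi> (\<phi> x)" using that by (simp add: fibre_def)
    ultimately show ?thesis using conn connected_iff_connected_component by blast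
  qed
  have \<omega>: "\<omega> (\<phi> x) = Omega A \<phi> x" if "x \<in> U" for x
    unfolding \<omega>_def by (rule Omega_fibre_component[OF that comp[OF that]])
  have "\<sigma> (\<phi> x) = Q_tau \<omega> (\<phi> x) x" if "x \<in> U" for x
    using fibre_component_diff[OF that comp[OF that]] that
    by (simp add: \<sigma>_def Q_tau_def Q_kernel_def \<omega> univ_kernel_Omega quot_map_eq_iff subspace_vertical)
  with \<omega> show ?thesis unfolding factors_Omega_def position_section_def by metis
qed

context
  fixes \<omega> :: "'b \<Rightarrow> ('a \<Rightarrow> complex) set"
  assumes factors: "factors_Omega A U \<phi> \<omega>"
begin

lemma omega_phi: "x \<in> U \<Longrightarrow> \<omega> (\<phi> x) = Omega A \<phi> x"
  using factors unfolding factors_Omega_def by simp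

lemma Q_kernel_phi: "x \<in> U \<Longrightarrow> Q_kernel \<omega> (\<phi> x) = vertical A \<phi> x"
  by (simp add: Q_kernel_def omega_phi univ_kernel_Omega)

lemma Q_J_phi:
  "x \<in> U \<Longrightarrow> Q_J \<omega> (\<phi> x) (quot_map (vertical A \<phi> x) v) = quot_map (vertical A \<phi> x) (induced_F A \<phi> x v)"
  by (simp add: Q_J_def omega_phi univ_J_Omega)

lemma frame_coord_fibre:
  assumes C: "C \<in> A" and x: "x \<in> frame_domain C e" and x': "x' \<in> frame_domain C e" and eq: "\<phi> x = \<phi> x'"
  shows "frame_coord C e x = frame_coord C e x'"
proof (rule complex_coordinates_unique[OF complex_coordinates_frame_coord[OF C x] complex_coordinates_frame_coord[OF C x'] _
        frame_coord_frame[OF C x] frame_coord_frame[OF C x']])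
  have "x \<in> U" "x' \<in> U" using x x' by (auto simp: frame_domain_def)
  then show "complex_functionals (induced_F A \<phi> x) = complex_functionals (induced_F A \<phi> x')"
    using omega_phi eq by (metis Omega_eq)
qed

text \<open>The normalized coordinates depend only on the point of \<open>N\<close>, since they are determined by
  \<open>\<omega>\<close> and the frame; they satisfy the Cauchy--Riemann equations because \<open>d\<phi>\<close> does.\<close>

lemma hol_trivialization_frame:
  assumes C: "C \<in> A"
  shows "\<exists>t. hol_trivialization A (Q_kernel \<omega>) (Q_J \<omega>) (\<phi> ` frame_domain C e)
    (t :: 'b \<Rightarrow> 'a set \<Rightarrow> complex^'n)"
proof -
  define B where "B = frame_domain C e"
  have BU: "B \<subseteq> U" by (auto simp: B_def frame_domain_def)
  define s where "s y = (SOME x. x \<in> B \<and> \<phi> x = y)" for y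
  define t where "t y E = frame_coord C e (s y) (SOME v. v \<in> E)" for y E
  have s: "s (\<phi> x) \<in> B" "\<phi> (s (\<phi> x)) = \<phi> x" if "x \<in> B" for x
    using someI[of "\<lambda>z. z \<in> B \<and> \<phi> z = \<phi> x" x] that by (simp_all add: s_def)
  have coord: "complex_coordinates (induced_F A \<phi> x) (frame_coord C e x)" if "x \<in> B" for x
    using complex_coordinates_frame_coord[OF C] that by (simp add: B_def)
  have vert: "v \<in> vertical A \<phi> x \<longleftrightarrow> frame_coord C e x v = 0" if "x \<in> B" for x v
    using complex_coordinates.ker_F[OF coord[OF that]] that BU by (auto simp: vertical_eq_ker_F)
  have t: "t (\<phi> x) (quot_map (vertical A \<phi> x) v) = frame_coord C e x v" if x: "x \<in> B" for x v
  proof -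
    have "v \<in> quot_map (vertical A \<phi> x) v"
      using subspace_0[OF subspace_vertical] x BU by (auto simp: mem_quot_map)
    then have "(SOME w. w \<in> quot_map (vertical A \<phi> x) v) - v \<in> vertical A \<phi> x"
      by (metis mem_quot_map someI)
    moreover have "frame_coord C e (s (\<phi> x)) = frame_coord C e x"
      using frame_coord_fibre[OF C, of "s (\<phi> x)" e x] s[OF x] x by (simp add: B_def)
    ultimately show ?thesis
      by (simp add: t_def vert[OF x] linear_diff[OF complex_coordinates.linear_T[OF coord[OF x]]])
  qed
  have "hol_trivialization A (Q_kernel \<omega>) (Q_J \<omega>) (\<phi> ` B) t"
    unfolding hol_trivialization_def
  proof (intro conjI ballI allI)
    show "open (\<phi> ` B)" using open_image_phi open_frame_domain[OF C] BU by (simp add: B_def)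
  next
    fix y assume "y \<in> \<phi> ` B"
    then obtain x where x: "x \<in> B" "y = \<phi> x" by blast
    then have xU: "x \<in> U" using BU by blast
    have K: "Q_kernel \<omega> y = vertical A \<phi> x" using Q_kernel_phi[OF xU] x by simp
    have ty: "t y (quot_map (vertical A \<phi> x) v) = frame_coord C e x v" for v using t x by simp
    interpret complex_coordinates "induced_F A \<phi> x" "frame_coord C e x" by (rule coord[OF x(1)])
    have "t y \<circ> quot_map (Q_kernel \<omega> y) = frame_coord C e x" by (rule ext) (simp add: K ty)
    then show "linear (t y \<circ> quot_map (Q_kernel \<omega> y))" using linear_T by simp
    show "bij_betw (t y) (quot_space (Q_kernel \<omega> y)) UNIV"
      unfolding bij_betw_def
    proof
      show "inj_on (t y) (quot_space (Q_kernel \<omega> y))"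
      proof (rule inj_onI, unfold quot_space_def K, elim rangeE)
        fix E E' v w assume "t y E = t y E'" "E = quot_map (vertical A \<phi> x) v" "E' = quot_map (vertical A \<phi> x) w"
        then show "E = E'"
          by (simp add: ty quot_map_eq_iff[OF subspace_vertical[OF xU]] vert[OF x(1)] linear_diff[OF linear_T])
      qed
      show "t y ` quot_space (Q_kernel \<omega> y) = UNIV"
        using surj_T by (simp add: quot_space_def K image_image ty)
    qed
    fix E assume "E \<in> quot_space (Q_kernel \<omega> y)"
    then obtain v where "E = quot_map (vertical A \<phi> x) v" by (auto simp: quot_space_def K)
    then show "t y (Q_J \<omega> y E) = \<i> *s t y E" using Q_J_phi[OF xU, folded x(2)] by (simp add: ty T_F)
  next
    fix v
    show "holomorphic_map_on A (\<phi> ` B) (\<lambda>y. t y (quot_map (Q_kernel \<omega> y) v))"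
    proof (rule holomorphic_map_onI)
      fix y assume "y \<in> \<phi> ` B"
      then obtain x where x: "x \<in> B" "y = \<phi> x" by blast
      have "CR_at x (\<lambda>x. t (\<phi> x) (quot_map (Q_kernel \<omega> (\<phi> x)) v) $ i)" for i
      proof (rule CR_at_cong)
        show "CR_at x (\<lambda>x. frame_coord C e x v $ i)"
          using CR_at_frame_coord[OF C] x by (simp add: B_def)
        show "open B" using open_frame_domain[OF C] by (simp add: B_def)
        show "frame_coord C e z v $ i = t (\<phi> z) (quot_map (Q_kernel \<omega> (\<phi> z)) v) $ i" if "z \<in> B" for z
          using t[OF that] Q_kernel_phi[of z] that BU by auto
      qed (rule x(1))
      then show "\<exists>x\<in>U. \<phi> x = y \<and> (\<forall>i. CR_at x (\<lambda>x. t (\<phi> x) (quot_map (Q_kernel \<omega> (\<phi> x)) v) $ i))"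
        using x BU by blast
    qed
  qed
  then show ?thesis unfolding B_def by blast
qed

lemma holomorphic_isotropic_quotient_Q:
  assumes onto: "\<phi> ` U = UNIV"
  shows "holomorphic_isotropic_quotient TYPE('n) A (Q_kernel \<omega>) (Q_J \<omega>)"
  unfolding holomorphic_isotropic_quotient_def
proof (intro conjI allI)
  fix y
  obtain x where x: "x \<in> U" "y = \<phi> x" using onto by (metis UNIV_I imageE)
  show "isotropic_quotient CARD('n) (Q_kernel \<omega> y) (Q_J \<omega> y)"
    using isotropic_quotient_Omega[OF x(1)] omega_phi[OF x(1)]
    by (simp add: Q_kernel_def[abs_def] Q_J_def[abs_def] x(2))
  obtain C where C: "C \<in> A" "\<phi> x \<in> fst C" by (rule chart_around)
  define e where "e j = inv (dphi C x) (axis j 1)" for j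
  \<comment> \<open>the frame is chosen so that the frame matrix at \<open>x\<close> is the unit matrix\<close>
  have "frame_matrix C e x = mat 1"
    by (simp add: frame_matrix_def e_def surj_f_inv_f[OF surj_dphi[OF C(1) x(1) C(2)]] vec_eq_iff
        mat_def axis_def)
  then have "x \<in> frame_domain C e" using x C by (simp add: frame_domain_def)
  then have "y \<in> \<phi> ` frame_domain C e" using x by blast
  with hol_trivialization_frame[OF C(1), of e]
  show "\<exists>W (t :: 'b \<Rightarrow> 'a set \<Rightarrow> complex^'n). y \<in> W \<and> hol_trivialization A (Q_kernel \<omega>) (Q_J \<omega>) W t"
    by blast
qed

text \<open>In a trivialization \<open>t\<close> the section is \<open>x \<mapsto> t (\<phi> x) x\<close> on \<open>U\<close>, where \<open>x\<close> enters both as a point of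
  a fibre and as a vector; in both roles the derivative is complex linear.\<close>

lemma holomorphic_section_position:
  assumes onto: "\<phi> ` U = UNIV" and \<sigma>: "position_section U \<phi> \<omega> \<sigma>"
  shows "holomorphic_section TYPE('n) A (Q_kernel \<omega>) (Q_J \<omega>) \<sigma>"
  unfolding holomorphic_section_def
proof (intro conjI allI impI)
  have \<sigma>_phi: "\<sigma> (\<phi> x) = quot_map (Q_kernel \<omega> (\<phi> x)) x" if "x \<in> U" for x
    using \<sigma> that unfolding position_section_def Q_tau_def by blast
  have preimage: "\<exists>x\<in>U. \<phi> x = y" for y using onto by (metis UNIV_I imageE)
  show "\<sigma> y \<in> quot_space (Q_kernel \<omega> y)" for y
    using preimage[of y] \<sigma>_phi by (auto simp: quot_map_in_quot_space)
  fix W and t :: "'b \<Rightarrow> 'a set \<Rightarrow> complex^'n"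
  assume triv: "hol_trivialization A (Q_kernel \<omega>) (Q_J \<omega>) W t"
  have W: "open W" using triv unfolding hol_trivialization_def by blast
  define \<tau> where "\<tau> y v = t y (quot_map (Q_kernel \<omega> y) v)" for y v
  have lin: "linear (\<tau> y)" if "y \<in> W" for y
    using triv that unfolding hol_trivialization_def \<tau>_def[abs_def] o_def by blast
  have tJ: "t y (Q_J \<omega> y E) = \<i> *s t y E" if "y \<in> W" "E \<in> quot_space (Q_kernel \<omega> y)" for y E
    using triv that unfolding hol_trivialization_def by blast
  have hol: "holomorphic_map_on A W (\<lambda>y. \<tau> y v)" for v
    using triv unfolding hol_trivialization_def \<tau>_def by blast
  show "holomorphic_map_on A W (\<lambda>y. t y (\<sigma> y))"
  proof (rule holomorphic_map_onI)
    fix y assume "y \<in> W"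
    obtain x where x: "x \<in> U" "\<phi> x = y" using preimage by blast
    then have xW: "\<phi> x \<in> W" using \<open>y \<in> W\<close> by simp
    define S where "S = U \<inter> \<phi> -` W"
    have S: "open S" "x \<in> S"
      using continuous_open_preimage[OF continuous_phi open_U W] x xW by (auto simp: S_def)
    have \<tau>F: "\<tau> (\<phi> x) (induced_F A \<phi> x u) = \<i> *s \<tau> (\<phi> x) u" for u
      using tJ[OF xW quot_map_in_quot_space, of u] Q_J_phi[OF x(1), of u]
      by (simp add: \<tau>_def Q_kernel_phi[OF x(1)])
    have expand: "\<tau> z v = (\<Sum>b\<in>Basis. (v \<bullet> b) *\<^sub>R \<tau> z b)" if "z \<in> W" for z v
    proof -
      have "\<tau> z (\<Sum>b\<in>Basis. (v \<bullet> b) *\<^sub>R b) = (\<Sum>b\<in>Basis. (v \<bullet> b) *\<^sub>R \<tau> z b)"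
        by (simp add: linear_sum[OF lin[OF that]] linear_scale[OF lin[OF that]])
      then show ?thesis by (simp add: euclidean_representation)
    qed
    have "CR_at x (\<lambda>x. t (\<phi> x) (\<sigma> (\<phi> x)) $ i)" for i
    proof -
      have "\<forall>b. \<exists>L. ((\<lambda>x. \<tau> (\<phi> x) b $ i) has_derivative L) (at x) \<and>
          (\<forall>u. P x u = u \<longrightarrow> L (induced_F A \<phi> x u) = \<i> * L u)"
        using holomorphic_map_on_imp_CR_at[OF hol W x(1) xW] unfolding CR_at_def by blast
      then obtain L where L: "\<And>b. ((\<lambda>x. \<tau> (\<phi> x) b $ i) has_derivative L b) (at x)"
        "\<And>b u. P x u = u \<Longrightarrow> L b (induced_F A \<phi> x u) = \<i> * L b u" by metis
      have eq: "(\<Sum>b\<in>Basis. (v \<bullet> b) *\<^sub>R (\<tau> z b $ i)) = \<tau> z v $ i" if "z \<in> W" for z v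
        by (subst expand[OF that, of v]) simp
      have "CR_at x (\<lambda>x. \<Sum>b\<in>Basis. (x \<bullet> b) *\<^sub>R (\<tau> (\<phi> x) b $ i))"
      proof (rule CR_atI)
        show "((\<lambda>x. \<Sum>b\<in>Basis. (x \<bullet> b) *\<^sub>R (\<tau> (\<phi> x) b $ i)) has_derivative
            (\<lambda>u. \<Sum>b\<in>Basis. (x \<bullet> b) *\<^sub>R L b u + (u \<bullet> b) *\<^sub>R (\<tau> (\<phi> x) b $ i))) (at x)"
          by (intro has_derivative_sum has_derivative_scaleR has_derivative_inner_left
              has_derivative_ident L(1))
        show "(\<Sum>b\<in>Basis. (x \<bullet> b) *\<^sub>R L b (induced_F A \<phi> x u) + (induced_F A \<phi> x u \<bullet> b) *\<^sub>R (\<tau> (\<phi> x) b $ i))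
            = \<i> * (\<Sum>b\<in>Basis. (x \<bullet> b) *\<^sub>R L b u + (u \<bullet> b) *\<^sub>R (\<tau> (\<phi> x) b $ i))" if "P x u = u" for u
          by (simp add: sum.distrib eq[OF xW] \<tau>F L(2)[OF that] distrib_left sum_distrib_left)
      qed
      then show ?thesis
      proof (rule CR_at_cong[OF _ S])
        fix z assume "z \<in> S"
        then have z: "z \<in> U" "\<phi> z \<in> W" by (auto simp: S_def)
        show "(\<Sum>b\<in>Basis. (z \<bullet> b) *\<^sub>R (\<tau> (\<phi> z) b $ i)) = t (\<phi> z) (\<sigma> (\<phi> z)) $ i"
          unfolding \<sigma>_phi[OF z(1)] \<tau>_def[symmetric] by (rule eq[OF z(2)])
      qed
    qed
    with x show "\<exists>x\<in>U. \<phi> x = y \<and> (\<forall>i. CR_at x (\<lambda>x. t (\<phi> x) (\<sigma> (\<phi> x)) $ i))" by blast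
  qed
qed

lemma fibre_openin:
  assumes \<sigma>: "position_section U \<phi> \<omega> \<sigma>" and x: "x \<in> U"
  shows "openin (top_of_set ((\<lambda>v. x + v) ` vertical A \<phi> x)) (fibre U \<phi> (\<phi> x))"
proof (rule fibre_piece_openin[OF x])
  fix y assume "y \<in> fibre U \<phi> (\<phi> x)"
  then have y: "y \<in> U" "\<phi> y = \<phi> x" by (auto simp: fibre_def)
  have vert: "vertical A \<phi> y = vertical A \<phi> x"
    using Q_kernel_phi[OF x] Q_kernel_phi[OF y(1)] y(2) by simp
  have "\<sigma> (\<phi> x) = quot_map (vertical A \<phi> x) x" "\<sigma> (\<phi> y) = quot_map (vertical A \<phi> y) y"
    using \<sigma> x y(1) unfolding position_section_def Q_tau_def by (simp_all add: Q_kernel_phi)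
  then have "quot_map (vertical A \<phi> x) y = quot_map (vertical A \<phi> x) x"
    by (simp add: vert y(2))
  then have "y - x \<in> vertical A \<phi> x" by (simp add: quot_map_eq_iff[OF subspace_vertical[OF x]])
  with y vert
  show "y \<in> U \<and> \<phi> y = \<phi> x \<and> y - x \<in> vertical A \<phi> x \<and> vertical A \<phi> y = vertical A \<phi> x" by blast
qed (rule connected_component_subset)

end

end

theorem theorem3p4:
  fixes U :: "'a::euclidean_space set"
    and A :: "('b::{t2_space,second_countable_topology}, 'n::finite) chart set"
    and g :: "('b, 'n) metric"
    and \<phi> :: "'a \<Rightarrow> 'b"
  assumes "open U" and "connected U" and "U \<noteq> {}"
    and "kaehler_manifold A g"
    and "submersion A U \<phi>" and "\<phi> ` U = UNIV"
    and "sPHH A U \<phi>"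
    and "totally_geodesic_fibres A U \<phi>"
  shows
    "(\<forall>v. smooth_on U (\<lambda>x. induced_F A \<phi> x v)) \<and>
     (\<forall>x\<in>U. Omega A \<phi> x \<in> orth_grassmannian CARD('n) \<and>
            univ_kernel (Omega A \<phi> x) = vertical A \<phi> x \<and>
            dim (vertical A \<phi> x) + 2 * CARD('n) = DIM('a)) \<and>
     (\<forall>x\<in>U. \<forall>x'\<in>connected_component_set (fibre U \<phi> (\<phi> x)) x. Omega A \<phi> x' = Omega A \<phi> x) \<and>
     (\<forall>x\<in>U. openin (top_of_set ((\<lambda>v. x + v) ` vertical A \<phi> x))
              (connected_component_set (fibre U \<phi> (\<phi> x)) x)) \<and>
     ((\<forall>y. connected (fibre U \<phi> y)) \<longrightarrow>
        (\<exists>\<omega> \<sigma>. factors_Omega A U \<phi> \<omega> \<and> position_section U \<phi> \<omega> \<sigma>)) \<and>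
     (\<forall>\<omega> \<sigma>. factors_Omega A U \<phi> \<omega> \<longrightarrow> position_section U \<phi> \<omega> \<sigma> \<longrightarrow>
        (\<forall>x\<in>U. openin (top_of_set ((\<lambda>v. x + v) ` vertical A \<phi> x)) (fibre U \<phi> (\<phi> x))) \<and>
        holomorphic_isotropic_quotient TYPE('n) A (Q_kernel \<omega>) (Q_J \<omega>) \<and>
        holomorphic_section TYPE('n) A (Q_kernel \<omega>) (Q_J \<omega>) \<sigma>)"
proof -
  have "complex_atlas A" using assms(4) unfolding kaehler_manifold_def by blast
  then interpret sphh_submersion U A \<phi>
    using assms by unfold_locales
  show ?thesis
  proof (intro conjI allI ballI impI)
    show "\<exists>\<omega> \<sigma>. factors_Omega A U \<phi> \<omega> \<and> position_section U \<phi> \<omega> \<sigma>" if "\<forall>y. connected (fibre U \<phi> y)"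
      using connected_fibres_factorization that by blast
  next
    fix x x' assume "x \<in> U" "x' \<in> connected_component_set (fibre U \<phi> (\<phi> x)) x"
    then show "Omega A \<phi> x' = Omega A \<phi> x" by (rule Omega_fibre_component)
  qed (use Omega_properties smooth_F fibre_component_openin fibre_openin
      holomorphic_isotropic_quotient_Q[OF _ assms(6)] holomorphic_section_position[OF _ assms(6)] in auto)
qed

end
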